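(* Let $n\ge2$ and let $\gamma_0\in\dot C^\infty(\mathbb{R};\mathbb{R}^n)$, with $\inf_{\mathbb{R}}|\partial_x\gamma_0|>0$, be the profile curve of either a non-scaling or an expanding soliton to one of the following flows: the curve shortening flow $\partial_t\gamma=\kappa$, the surface diffusion flow $\partial_t\gamma=-\nabla_s^2\kappa$, or Chen's flow $\partial_t\gamma=-\partial_s^4\gamma$. Suppose that $D[\gamma_0]<\infty$. Then $\gamma_0$ is a straight line.
   Context: $\{e_j\}_{j=1}^n$ is the canonical basis of $\mathbb{R}^n$ and $\mathbb{N}_0=\{0,1,2,\dots\}$. For an immersed curve $\gamma$ (or each curve $\gamma(t,\cdot)$ of a family), $\partial_s=|\partial_x\gamma|^{-1}\partial_x$, $ds=|\partial_x\gamma|\,dx$, $\kappa=\partial_s^2\gamma$, and $\nabla_sf=\partial_sf-\langle\partial_sf,\partial_s\gamma\rangle\partial_s\gamma$. The direction energy is $D[\gamma]=\frac12\int_\gamma|\partial_s\gamma-e_1|^2\,ds$. One has $-\partial_s^4\gamma=-\nabla_s^2\kappa+|\kappa|^2\kappa+3\langle\kappa,\partial_s\kappa\rangle\partial_s\gamma$. $\dot C^\infty(\mathbb{R};\mathbb{R}^n)$ is the space of smooth maps $u:\mathbb{R}\to\mathbb{R}^n$ all of whose derivatives of order $\ge1$ are bounded on $\mathbb{R}$. $C^\infty([0,T']\times\mathbb{R})$ denotes the maps all of whose derivatives $\partial_t^\alpha\partial_x^\beta u$, $\alpha,\beta\in\mathbb{N}_0$, are bounded on $[0,T']\times\mathbb{R}$.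 Maximal existence time: $T\in(0,\infty]$ is the supremum of all $T'\in(0,\infty)$ such that there is a unique smooth solution $\gamma:[0,T']\times\mathbb{R}\to\mathbb{R}^n$ of the flow starting from $\gamma_0$ with $\gamma-\gamma_0\in C^\infty([0,T']\times\mathbb{R})$ and $\inf_{[0,T']\times\mathbb{R}}|\partial_x\gamma|>0$. Solitons: let $\gamma:[0,T)\times\mathbb{R}\to\mathbb{R}^n$ be a solution to a flow with maximal existence time $T\in(0,\infty]$ and initial datum $\gamma_0$. It is an expanding soliton if there is an increasing function $\alpha:[0,T)\to(0,\infty)$ with $\alpha(0)=1$ and $\lim_{t\to T}\alpha(t)=\infty$ such that $\gamma(t)$ is isometric to $\alpha(t)\gamma_0$ for all $t\in[0,T)$. It is a non-scaling soliton if $T=\infty$ and $\gamma(t)$ is isometric to $\gamma_0$ for all $t\ge0$. Here two curves are isometric if, up to reparametrization, one is the image of the other under an isometry of $\mathbb{R}^n$. In all cases $\gamma_0$ is called the profile curve of the soliton. *)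

theory Defs
  imports "HOL-Analysis.Analysis"
begin

abbreviation dx :: "(real \<Rightarrow> 'a::real_normed_vector) \<Rightarrow> real \<Rightarrow> 'a"
  where "dx u \<equiv> (\<lambda>x. vector_derivative u (at x))"

definition smooth :: "(real \<Rightarrow> 'a::real_normed_vector) \<Rightarrow> bool"
  where "smooth u \<longleftrightarrow> (\<forall>k x. (dx ^^ k) u differentiable (at x))"

text \<open>The space \<open>\<dot>C\<^sup>\<infinity>(\<real>)\<close>; the map itself may be unbounded.\<close>

definition dot_smooth :: "(real \<Rightarrow> 'a::real_normed_vector) \<Rightarrow> bool"
  where "dot_smooth u \<longleftrightarrow> smooth u \<and> (\<forall>k\<ge>1. bounded (range ((dx ^^ k) u)))"

text \<open>
  A map on \<open>[0,T'] \<times> \<real>\<close> is a total function \<open>u t x\<close> of which only the values with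
  \<open>t \<in> {0..T'}\<close> matter: time derivatives are taken within \<open>{0..T'}\<close>, hence one-sided at
  \<open>t = 0\<close> and \<open>t = T'\<close>.
\<close>

definition partial_x :: "(real \<Rightarrow> real \<Rightarrow> 'a::real_normed_vector) \<Rightarrow> real \<Rightarrow> real \<Rightarrow> 'a"
  where "partial_x u t x = vector_derivative (u t) (at x)"

definition partial_t :: "real \<Rightarrow> (real \<Rightarrow> real \<Rightarrow> 'a::real_normed_vector) \<Rightarrow> real \<Rightarrow> real \<Rightarrow> 'a"
  where "partial_t T' u t x = vector_derivative (\<lambda>s. u s x) (at t within {0..T'})"

definition partial ::
  "real \<Rightarrow> nat \<Rightarrow> nat \<Rightarrow> (real \<Rightarrow> real \<Rightarrow> 'a::real_normed_vector) \<Rightarrow> real \<Rightarrow> real \<Rightarrow> 'a"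
  where "partial T' \<alpha> \<beta> u = (partial_t T' ^^ \<alpha>) ((partial_x ^^ \<beta>) u)"

definition smooth_strip :: "real \<Rightarrow> (real \<Rightarrow> real \<Rightarrow> 'a::real_normed_vector) \<Rightarrow> bool"
  where "smooth_strip T' u \<longleftrightarrow>
    (\<forall>\<alpha> \<beta>. continuous_on ({0..T'} \<times> UNIV) (\<lambda>(t, x). partial T' \<alpha> \<beta> u t x) \<and>
      (\<forall>t\<in>{0..T'}. \<forall>x.
        (\<lambda>s. partial T' \<alpha> \<beta> u s x) differentiable (at t within {0..T'}) \<and>
        partial T' \<alpha> \<beta> u t differentiable (at x)))"

definition bounded_smooth_strip :: "real \<Rightarrow> (real \<Rightarrow> real \<Rightarrow> 'a::real_normed_vector) \<Rightarrow> bool"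
  where "bounded_smooth_strip T' u \<longleftrightarrow> smooth_strip T' u \<and>
    (\<forall>\<alpha> \<beta>. bounded ((\<lambda>(t, x). partial T' \<alpha> \<beta> u t x) ` ({0..T'} \<times> UNIV)))"

definition arc_deriv ::
  "(real \<Rightarrow> 'a::real_normed_vector) \<Rightarrow> (real \<Rightarrow> 'b::real_normed_vector) \<Rightarrow> real \<Rightarrow> 'b"
  where "arc_deriv c f x = (1 / norm (dx c x)) *\<^sub>R dx f x"

definition unit_tangent :: "(real \<Rightarrow> 'a::real_inner) \<Rightarrow> real \<Rightarrow> 'a"
  where "unit_tangent c = arc_deriv c c"

definition curvature :: "(real \<Rightarrow> 'a::real_inner) \<Rightarrow> real \<Rightarrow> 'a"
  where "curvature c = (arc_deriv c ^^ 2) c"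

definition normal_deriv :: "(real \<Rightarrow> 'a::real_inner) \<Rightarrow> (real \<Rightarrow> 'a) \<Rightarrow> real \<Rightarrow> 'a"
  where "normal_deriv c f x =
    arc_deriv c f x - (arc_deriv c f x \<bullet> unit_tangent c x) *\<^sub>R unit_tangent c x"

definition direction_energy :: "'a::euclidean_space \<Rightarrow> (real \<Rightarrow> 'a) \<Rightarrow> ennreal"
  where "direction_energy e c =
    (\<integral>\<^sup>+ x. ennreal ((norm (unit_tangent c x - e))\<^sup>2 * norm (dx c x)) \<partial>lborel) / 2"

definition reparametrization :: "(real \<Rightarrow> real) \<Rightarrow> bool"
  where "reparametrization \<phi> \<longleftrightarrow> bij \<phi> \<and> smooth \<phi> \<and> smooth (inv \<phi>)"

definition isometric_curves :: "(real \<Rightarrow> 'a::euclidean_space) \<Rightarrow> (real \<Rightarrow> 'a) \<Rightarrow> bool"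
  where "isometric_curves c d \<longleftrightarrow>
    (\<exists>\<Phi> \<phi>. (\<forall>p q. dist (\<Phi> p) (\<Phi> q) = dist p q) \<and> reparametrization \<phi> \<and>
      c = \<Phi> \<circ> d \<circ> \<phi>)"

definition straight_line :: "(real \<Rightarrow> 'a::euclidean_space) \<Rightarrow> bool"
  where "straight_line c \<longleftrightarrow>
    (\<exists>p v \<phi>. v \<noteq> 0 \<and> reparametrization \<phi> \<and> c = (\<lambda>x. p + \<phi> x *\<^sub>R v))"

text \<open>
  A flow \<open>\<partial>\<^sub>t\<gamma> = V[\<gamma>]\<close> is given by the operator \<open>V\<close> that maps a curve to its velocity field.
\<close>

type_synonym 'a velocity = "(real \<Rightarrow> 'a) \<Rightarrow> real \<Rightarrow> 'a"

definition curve_shortening :: "'a::real_inner velocity"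
  where "curve_shortening c = curvature c"

definition surface_diffusion :: "'a::real_inner velocity"
  where "surface_diffusion c x = - (normal_deriv c ^^ 2) (curvature c) x"

definition chen :: "'a::real_inner velocity"
  where "chen c x = - (arc_deriv c ^^ 4) c x"

definition flow_solution ::
  "'a::euclidean_space velocity \<Rightarrow> (real \<Rightarrow> 'a) \<Rightarrow> real \<Rightarrow> (real \<Rightarrow> real \<Rightarrow> 'a) \<Rightarrow> bool"
  where "flow_solution V \<gamma>0 T' \<gamma> \<longleftrightarrow>
    smooth_strip T' \<gamma> \<and>
    (\<forall>t\<in>{0..T'}. \<forall>x. partial_t T' \<gamma> t x = V (\<gamma> t) x) \<and>
    \<gamma> 0 = \<gamma>0 \<and>
    bounded_smooth_strip T' (\<lambda>t x. \<gamma> t x - \<gamma>0 x) \<and>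
    0 < (INF (t, x)\<in>{0..T'} \<times> UNIV. norm (partial_x \<gamma> t x))"

definition maximal_time :: "'a::euclidean_space velocity \<Rightarrow> (real \<Rightarrow> 'a) \<Rightarrow> ereal"
  where "maximal_time V \<gamma>0 = Sup (ereal ` {T'. 0 < T' \<and>
    (\<exists>\<gamma>. flow_solution V \<gamma>0 T' \<gamma> \<and>
      (\<forall>\<eta>. flow_solution V \<gamma>0 T' \<eta> \<longrightarrow> (\<forall>t\<in>{0..T'}. \<forall>x. \<eta> t x = \<gamma> t x)))})"

text \<open>
  \<open>0 < T\<close> is not automatic: \<^const>\<open>maximal_time\<close> is \<open>-\<infinity>\<close> if no \<open>T'\<close> is admissible.
\<close>

definition maximal_solution ::
  "'a::euclidean_space velocity \<Rightarrow> (real \<Rightarrow> 'a) \<Rightarrow> ereal \<Rightarrow> (real \<Rightarrow> real \<Rightarrow> 'a) \<Rightarrow> bool"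
  where "maximal_solution V \<gamma>0 T \<gamma> \<longleftrightarrow>
    0 < T \<and> T = maximal_time V \<gamma>0 \<and>
    (\<forall>T'. 0 < T' \<and> ereal T' < T \<longrightarrow> flow_solution V \<gamma>0 T' \<gamma>)"

text \<open>
  The profile curve is the initial datum, so both predicates are stated for it and quantify
  the soliton existentially. ``Increasing'' is taken in the non-strict sense.
\<close>

definition non_scaling_profile :: "'a::euclidean_space velocity \<Rightarrow> (real \<Rightarrow> 'a) \<Rightarrow> bool"
  where "non_scaling_profile V \<gamma>0 \<longleftrightarrow>
    (\<exists>\<gamma>. maximal_solution V \<gamma>0 \<infinity> \<gamma> \<and> (\<forall>t\<ge>0. isometric_curves (\<gamma> t) \<gamma>0))"

definition expanding_profile :: "'a::euclidean_space velocity \<Rightarrow> (real \<Rightarrow> 'a) \<Rightarrow> bool"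
  where "expanding_profile V \<gamma>0 \<longleftrightarrow>
    (\<exists>\<gamma> T. maximal_solution V \<gamma>0 T \<gamma> \<and>
      (\<exists>\<alpha>. mono_on {t. 0 \<le> t \<and> ereal t < T} \<alpha> \<and>
        (\<forall>t. 0 \<le> t \<and> ereal t < T \<longrightarrow> 0 < \<alpha> t) \<and>
        \<alpha> 0 = 1 \<and>
        filterlim \<alpha> at_top (if T = \<infinity> then at_top else at_left (real_of_ereal T)) \<and>
        (\<forall>t. 0 \<le> t \<and> ereal t < T \<longrightarrow> isometric_curves (\<gamma> t) (\<lambda>x. \<alpha> t *\<^sub>R \<gamma>0 x))))"

end

theory Submission
  imports Defs
begin

text \<open>
  Written as \<open>\<integral> (\<bar>\<gamma>\<^sub>x\<bar> - \<langle>\<gamma>\<^sub>x, e\<rangle>) dx\<close>, the direction energy is length minus displacement. Its first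
  variation is therefore that of length, and along each of the three flows it is dissipated at the
  rate \<open>\<integral> \<bar>w\<bar>\<^sup>2 ds\<close>, where \<open>w\<close> is \<open>\<kappa>\<close>, \<open>\<nabla>\<^sub>s \<kappa>\<close> or \<open>\<partial>\<^sub>s \<kappa>\<close>
  (\<open>velocity_is_gradient\<close>, \<open>energy_deriv\<close>). On a soliton, on the other hand, the energy cannot
  decrease: isometries move the direction \<open>e\<close> to some unit vector \<open>e'\<close> and dilations multiply the
  energy by \<open>\<alpha> \<ge> 1\<close>, while a curve of infinite length with finite energy in direction \<open>e\<close> has
  infinite energy in every other direction (\<open>isometric_recovers_energy\<close>). Hence \<open>w\<close> vanishes on the
  profile curve, whose curvature then has constant length.

  The curves are not compact, so the energy is balanced over \<open>[-n, n]\<close> and boundary terms appear.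
  All derivatives being bounded, these terms are bounded uniformly in time and \<open>n\<close>, which already
  keeps the energy finite at all times. Finite energy in turn forces \<open>T \<longrightarrow> e\<close> and \<open>\<kappa> \<longrightarrow> 0\<close> at both
  ends (\<open>straight_ends\<close>). So the boundary terms vanish as \<open>n \<longrightarrow> \<infinity>\<close>, first at each time and then, by
  dominated convergence, after integration in time (\<open>boundary_work_vanishes\<close>). The balance in the
  limit is \<open>no_dissipation\<close>. Since \<open>\<kappa>\<close> vanishes at the ends and has constant length, it is zero and
  the profile is a line.
\<close>

section \<open>Families of curves with bounded derivatives\<close>

definition bounded_cont :: "real set \<Rightarrow> (real \<Rightarrow> real \<Rightarrow> 'a::real_normed_vector) \<Rightarrow> bool"
  where "bounded_cont I f \<longleftrightarrow> continuous_on (I \<times> UNIV) (\<lambda>(t, x). f t x) \<and>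
    bounded ((\<lambda>(t, x). f t x) ` (I \<times> UNIV))"

text \<open>
  Arclength derivatives of a curve with speed bounded below are rational expressions in its
  space derivatives. Bounding all space derivatives uniformly in time therefore bounds every
  geometric quantity of the flow at once. The recursion on the order is chosen so that the
  closure properties below become inductions through the product rule.
\<close>

primrec tame_upto :: "nat \<Rightarrow> real set \<Rightarrow> (real \<Rightarrow> real \<Rightarrow> 'a::real_normed_vector) \<Rightarrow> bool"
  where
    "tame_upto 0 I f \<longleftrightarrow> bounded_cont I f"
  | "tame_upto (Suc k) I f \<longleftrightarrow> bounded_cont I f \<and>
      (\<forall>t\<in>I. \<forall>x. f t differentiable (at x)) \<and> tame_upto k I (\<lambda>t. dx (f t))"

definition tame :: "real set \<Rightarrow> (real \<Rightarrow> real \<Rightarrow> 'a::real_normed_vector) \<Rightarrow> bool"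
  where "tame I f \<longleftrightarrow> (\<forall>k. tame_upto k I f)"

lemma bounded_cont_cong:
  assumes "\<And>t x. t \<in> I \<Longrightarrow> f t x = g t x"
  shows "bounded_cont I f \<longleftrightarrow> bounded_cont I g"
proof -
  have "continuous_on (I \<times> UNIV) (\<lambda>(t, x). f t x) \<longleftrightarrow> continuous_on (I \<times> UNIV) (\<lambda>(t, x). g t x)"
    using assms by (intro continuous_on_cong) auto
  moreover have "(\<lambda>(t, x). f t x) ` (I \<times> UNIV) = (\<lambda>(t, x). g t x) ` (I \<times> UNIV)"
    using assms by (intro image_cong) auto
  ultimately show ?thesis unfolding bounded_cont_def by simp
qed

lemma bounded_contI:
  assumes "continuous_on (I \<times> UNIV) (\<lambda>(t, x). f t x)"
    and "\<And>t x. t \<in> I \<Longrightarrow> norm (f t x) \<le> B"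
  shows "bounded_cont I f"
  using assms unfolding bounded_cont_def bounded_iff by auto

lemma bounded_cont_bound:
  assumes "bounded_cont I f"
  obtains B where "B > 0" "\<And>t x. t \<in> I \<Longrightarrow> norm (f t x) \<le> B"
proof -
  obtain B where "B > 0" "\<forall>y\<in>(\<lambda>(t, x). f t x) ` (I \<times> UNIV). norm y \<le> B"
    using assms unfolding bounded_cont_def bounded_pos by auto
  then show ?thesis using that[of B] by force
qed

lemma bounded_cont_add:
  assumes "bounded_cont I f" "bounded_cont I g"
  shows "bounded_cont I (\<lambda>t x. f t x + g t x)"
proof -
  obtain B where B: "B > 0" "\<And>t x. t \<in> I \<Longrightarrow> norm (f t x) \<le> B" using bounded_cont_bound[OF assms(1)] by blast
  obtain C where C: "C > 0" "\<And>t x. t \<in> I \<Longrightarrow> norm (g t x) \<le> C" using bounded_cont_bound[OF assms(2)] by blast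
  show ?thesis
  proof (rule bounded_contI[where B = "B + C"])
    show "continuous_on (I \<times> UNIV) (\<lambda>(t, x). f t x + g t x)"
      using continuous_on_add[of "I \<times> UNIV" "\<lambda>(t, x). f t x" "\<lambda>(t, x). g t x"] assms
      unfolding bounded_cont_def by (simp add: case_prod_unfold)
  qed (use B(2) C(2) in \<open>simp add: norm_triangle_mono\<close>)
qed

lemma bounded_cont_bilinear:
  assumes p: "bounded_bilinear p" and "bounded_cont I f" "bounded_cont I g"
  shows "bounded_cont I (\<lambda>t x. p (f t x) (g t x))"
proof -
  obtain B where B: "B > 0" "\<And>t x. t \<in> I \<Longrightarrow> norm (f t x) \<le> B" using bounded_cont_bound[OF assms(2)] by blast
  obtain C where C: "C > 0" "\<And>t x. t \<in> I \<Longrightarrow> norm (g t x) \<le> C" using bounded_cont_bound[OF assms(3)] by blast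
  obtain K where K: "K \<ge> 0" "\<And>a b. norm (p a b) \<le> norm a * norm b * K"
    using bounded_bilinear.nonneg_bounded[OF p] by blast
  show ?thesis
  proof (rule bounded_contI[where B = "B * C * K"])
    show "continuous_on (I \<times> UNIV) (\<lambda>(t, x). p (f t x) (g t x))"
      using bounded_bilinear.continuous_on[OF p, of "I \<times> UNIV" "\<lambda>(t, x). f t x" "\<lambda>(t, x). g t x"] assms
      unfolding bounded_cont_def by (simp add: case_prod_unfold)
    show "norm (p (f t x) (g t x)) \<le> B * C * K" if "t \<in> I" for t x
    proof -
      have "norm (p (f t x) (g t x)) \<le> norm (f t x) * norm (g t x) * K" by (rule K(2))
      also have "\<dots> \<le> B * C * K"
        using B C K(1) that by (intro mult_right_mono mult_mono) (auto intro: less_imp_le)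
      finally show ?thesis .
    qed
  qed
qed

lemma tame_upto_cong:
  assumes "\<And>t x. t \<in> I \<Longrightarrow> f t x = g t x"
  shows "tame_upto k I f \<longleftrightarrow> tame_upto k I g"
  using assms
proof (induction k arbitrary: f g)
  case 0
  then show ?case using bounded_cont_cong[of I f g] by simp
next
  case (Suc k)
  have eq: "f t = g t" if "t \<in> I" for t using Suc.prems that by auto
  have "tame_upto k I (\<lambda>t. dx (f t)) = tame_upto k I (\<lambda>t. dx (g t))"
    by (rule Suc.IH) (simp add: eq)
  then show ?case using eq bounded_cont_cong[of I f g] by simp
qed

lemma tame_upto_SucD: "tame_upto (Suc k) I f \<Longrightarrow> tame_upto k I f"
  by (induction k arbitrary: f) auto

lemma tame_upto_bounded_cont: "tame_upto k I f \<Longrightarrow> bounded_cont I f"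
  by (cases k) auto

lemma tame_upto_add:
  assumes "tame_upto k I f" "tame_upto k I g"
  shows "tame_upto k I (\<lambda>t x. f t x + g t x)"
  using assms
proof (induction k arbitrary: f g)
  case 0
  then show ?case by (simp add: bounded_cont_add)
next
  case (Suc k)
  have "tame_upto k I (\<lambda>t x. dx (f t) x + dx (g t) x)"
    using Suc by auto
  also have "?this \<longleftrightarrow> tame_upto k I (\<lambda>t. dx (\<lambda>x. f t x + g t x))"
    using Suc.prems by (intro tame_upto_cong) (simp add: vector_derivative_add_at)
  finally show ?case using Suc.prems by (simp add: bounded_cont_add)
qed

lemma tame_upto_bilinear:
  assumes p: "bounded_bilinear p" and "tame_upto k I f" "tame_upto k I g"
  shows "tame_upto k I (\<lambda>t x. p (f t x) (g t x))"
  using assms(2,3)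
proof (induction k arbitrary: f g)
  case 0
  then show ?case by (simp add: bounded_cont_bilinear[OF p])
next
  case (Suc k)
  have D: "((\<lambda>x. p (f t x) (g t x)) has_vector_derivative
      (p (f t x) (dx (g t) x) + p (dx (f t) x) (g t x))) (at x)" if "t \<in> I" for t x
    using Suc.prems that
    by (intro bounded_bilinear.has_vector_derivative[OF p]) (auto simp: vector_derivative_works[symmetric])
  have "tame_upto k I (\<lambda>t x. p (f t x) (dx (g t) x) + p (dx (f t) x) (g t x))"
    using Suc.prems tame_upto_SucD[OF Suc.prems(1)] tame_upto_SucD[OF Suc.prems(2)]
    by (intro tame_upto_add Suc.IH) auto
  also have "?this \<longleftrightarrow> tame_upto k I (\<lambda>t. dx (\<lambda>x. p (f t x) (g t x)))"
    using D by (intro tame_upto_cong vector_derivative_at[symmetric])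
  finally show ?case
    using Suc.prems D bounded_cont_bilinear[OF p] by (auto intro: differentiableI_vector)
qed

lemma norm_has_vector_derivative:
  fixes f :: "real \<Rightarrow> 'a::real_inner"
  assumes "(f has_vector_derivative f') (at x within S)" "f x \<noteq> 0"
  shows "((\<lambda>x. norm (f x)) has_vector_derivative (1 / norm (f x)) * (f x \<bullet> f')) (at x within S)"
proof -
  have "((\<lambda>x. norm (f x)) has_derivative (\<lambda>h. (h *\<^sub>R f') \<bullet> sgn (f x))) (at x within S)"
    using has_derivative_compose[OF assms(1)[unfolded has_vector_derivative_def] has_derivative_norm[OF assms(2)]]
    by (simp add: inner_commute)
  then show ?thesis
    unfolding has_vector_derivative_def
    by (simp add: sgn_div_norm inner_commute divide_inverse mult_ac)
qed

lemma inverse_norm_has_vector_derivative: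
  fixes f :: "real \<Rightarrow> 'a::real_inner"
  assumes "(f has_vector_derivative f') (at x within S)" "f x \<noteq> 0"
  shows "((\<lambda>x. 1 / norm (f x)) has_vector_derivative
    (1 / norm (f x)) * ((1 / norm (f x)) * (1 / norm (f x))) * ((- 1) * (f x \<bullet> f'))) (at x within S)"
proof -
  have "((\<lambda>x. norm (f x)) has_real_derivative (1 / norm (f x)) * (f x \<bullet> f')) (at x within S)"
    using norm_has_vector_derivative[OF assms] by (simp add: has_real_derivative_iff_has_vector_derivative)
  from DERIV_inverse_fun[OF this] assms(2) show ?thesis
    by (simp add: has_real_derivative_iff_has_vector_derivative divide_inverse algebra_simps)
qed

lemma tame_upto_const: "tame_upto k I (\<lambda>t x. c)"
proof (induction k arbitrary: c)
  case 0
  then show ?case by (auto intro!: bounded_contI[where B = "norm c"])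
next
  case (Suc k)
  then show ?case by (auto intro!: bounded_contI[where B = "norm c"])
qed

text \<open>
  The derivative of \<open>1 / \<bar>f\<bar>\<close> is a polynomial in \<open>1 / \<bar>f\<bar>\<close>, \<open>f\<close> and \<open>f'\<close>, so a bound of order \<open>k\<close> on
  \<open>1 / \<bar>f\<bar>\<close> yields one of order \<open>k + 1\<close>.
\<close>

lemma tame_inverse_norm:
  fixes f :: "real \<Rightarrow> real \<Rightarrow> 'a::real_inner"
  assumes f: "tame I f" and m: "m > 0" "\<And>t x. t \<in> I \<Longrightarrow> m \<le> norm (f t x)"
  shows "tame I (\<lambda>t x. 1 / norm (f t x))"
  unfolding tame_def
proof
  fix k
  have nz: "f t x \<noteq> 0" if "t \<in> I" for t x using m(2)[OF that, of x] m(1) by auto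
  have bc: "bounded_cont I (\<lambda>t x. 1 / norm (f t x))"
  proof (rule bounded_contI[where B = "1 / m"])
    have "bounded_cont I f" using f unfolding tame_def using tame_upto_bounded_cont by blast
    then have "continuous_on (I \<times> UNIV) (\<lambda>z. f (fst z) (snd z))"
      by (simp add: bounded_cont_def case_prod_unfold)
    then show "continuous_on (I \<times> UNIV) (\<lambda>(t, x). 1 / norm (f t x))"
      using nz by (auto simp: case_prod_unfold intro!: continuous_intros)
  qed (use m in \<open>auto intro!: divide_left_mono mult_pos_pos simp: nz\<close>)
  show "tame_upto k I (\<lambda>t x. 1 / norm (f t x))"
  proof (induction k)
    case 0
    then show ?case using bc by simp
  next
    case (Suc k)
    have df: "f t differentiable (at x)" if "t \<in> I" for t x
      using f that unfolding tame_def by (metis tame_upto.simps(2))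
    have D: "((\<lambda>x. 1 / norm (f t x)) has_vector_derivative (1 / norm (f t x)) *
      ((1 / norm (f t x)) * (1 / norm (f t x))) * ((- 1) * (f t x \<bullet> dx (f t) x))) (at x)" if "t \<in> I" for t x
      using df that nz
      by (intro inverse_norm_has_vector_derivative) (auto simp: vector_derivative_works[symmetric])
    have "tame_upto k I (\<lambda>t. dx (f t))" "tame_upto k I f"
      using f unfolding tame_def by (metis tame_upto.simps(2)) (use f tame_def in blast)
    then have "tame_upto k I (\<lambda>t x. (1 / norm (f t x)) *
      ((1 / norm (f t x)) * (1 / norm (f t x))) * ((- 1) * (f t x \<bullet> dx (f t) x)))"
      using Suc.IH
      by (intro tame_upto_bilinear[OF bounded_bilinear_mult] tame_upto_bilinear[OF bounded_bilinear_inner] tame_upto_const)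
    also have "?this \<longleftrightarrow> tame_upto k I (\<lambda>t. dx (\<lambda>x. 1 / norm (f t x)))"
      using D by (intro tame_upto_cong vector_derivative_at[symmetric])
    finally show ?case
      using D bc by (auto intro: differentiableI_vector)
  qed
qed

lemma tame_add: "tame I f \<Longrightarrow> tame I g \<Longrightarrow> tame I (\<lambda>t x. f t x + g t x)"
  by (simp add: tame_def tame_upto_add)

lemma tame_scaleR: "tame I f \<Longrightarrow> tame I g \<Longrightarrow> tame I (\<lambda>t x. f t x *\<^sub>R g t x)"
  by (simp add: tame_def tame_upto_bilinear[OF bounded_bilinear_scaleR])

lemma tame_inner: "tame I f \<Longrightarrow> tame I g \<Longrightarrow> tame I (\<lambda>t x. f t x \<bullet> g t x)"
  by (simp add: tame_def tame_upto_bilinear[OF bounded_bilinear_inner])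

lemma tame_const: "tame I (\<lambda>t x. c)"
  by (simp add: tame_def tame_upto_const)

lemma tame_uminus: "tame I f \<Longrightarrow> tame I (\<lambda>t x. - f t x)"
  using tame_scaleR[OF tame_const[of I "-1"]] by fastforce

lemma tame_diff: "tame I f \<Longrightarrow> tame I g \<Longrightarrow> tame I (\<lambda>t x. f t x - g t x)"
  using tame_add[OF _ tame_uminus] by fastforce

lemma tame_dx: "tame I f \<Longrightarrow> tame I (\<lambda>t. dx (f t))"
  by (metis tame_def tame_upto.simps(2))

lemma tame_has_dx: "tame I f \<Longrightarrow> t \<in> I \<Longrightarrow> (f t has_vector_derivative dx (f t) x) (at x)"
  by (metis tame_def tame_upto.simps(2) vector_derivative_works)

lemma tame_bounded_cont: "tame I f \<Longrightarrow> bounded_cont I f"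
  by (meson tame_def tame_upto.simps(1))

lemma tame_upto_funpow:
  assumes "\<And>j. bounded_cont I (\<lambda>t. (dx ^^ j) (f t))"
    and "\<And>j t x. t \<in> I \<Longrightarrow> (dx ^^ j) (f t) differentiable (at x)"
  shows "tame_upto k I f"
  using assms
proof (induction k arbitrary: f)
  case 0
  then show ?case using "0.prems"(1)[of 0] by simp
next
  case (Suc k)
  have "tame_upto k I (\<lambda>t. dx (f t))"
    using Suc.prems(1)[of "Suc j" for j] Suc.prems(2)[where j = "Suc j" for j]
    by (intro Suc.IH) (simp_all add: funpow_Suc_right del: funpow.simps)
  then show ?case using Suc.prems(1)[of 0] Suc.prems(2)[where j = 0] by simp
qed

lemma tame_funpow: 
  assumes "tame I f"
  shows "tame I (\<lambda>t. (dx ^^ k) (f t))"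
  by (induction k) (use assms tame_dx in \<open>simp_all\<close>)

section \<open>Arclength geometry and the gradient structure of the flows\<close>

lemma curvature_eq: "curvature c = arc_deriv c (unit_tangent c)"
  by (simp add: curvature_def unit_tangent_def eval_nat_numeral)

text \<open>
  The curves themselves may be unbounded; only their first derivative is required to be tame.
  The uniform lower bound on the speed makes arclength derivatives as good as derivatives in
  the parameter.
\<close>

locale curve_family =
  fixes I :: "real set" and \<gamma> :: "real \<Rightarrow> real \<Rightarrow> 'a::euclidean_space" and m :: real
  assumes tame_velocity: "tame I (\<lambda>t. dx (\<gamma> t))"
    and differentiable: "t \<in> I \<Longrightarrow> \<gamma> t differentiable (at x)"
    and m_pos: "m > 0"
    and speed_ge: "t \<in> I \<Longrightarrow> m \<le> norm (dx (\<gamma> t) x)"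
begin

lemma dx_nonzero: "t \<in> I \<Longrightarrow> dx (\<gamma> t) x \<noteq> 0"
  using speed_ge[of t x] m_pos by auto

text \<open>
  The hypothesis concerns the derivative of \<open>f\<close> because \<open>f\<close> is also taken to be the curve itself.
\<close>

lemma tame_arc_deriv:
  assumes "tame I (\<lambda>t. dx (f t))"
  shows "tame I (\<lambda>t. arc_deriv (\<gamma> t) (f t))"
  unfolding arc_deriv_def
  by (rule tame_scaleR[OF tame_inverse_norm[OF tame_velocity m_pos speed_ge] assms])

lemma tame_unit_tangent: "tame I (\<lambda>t. unit_tangent (\<gamma> t))"
  unfolding unit_tangent_def by (rule tame_arc_deriv[OF tame_velocity])

lemma tame_curvature: "tame I (\<lambda>t. curvature (\<gamma> t))"
  unfolding curvature_eq by (rule tame_arc_deriv[OF tame_dx[OF tame_unit_tangent]])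

lemma tame_normal_deriv:
  assumes "tame I f"
  shows "tame I (\<lambda>t. normal_deriv (\<gamma> t) (f t))"
  unfolding normal_deriv_def
  by (intro tame_diff tame_scaleR tame_inner tame_arc_deriv tame_dx assms tame_unit_tangent)

lemma arc_deriv_has_derivative:
  assumes "tame I f" "t \<in> I"
  shows "(f t has_vector_derivative norm (dx (\<gamma> t) x) *\<^sub>R arc_deriv (\<gamma> t) (f t) x) (at x)"
  using tame_has_dx[OF assms, of x] dx_nonzero[OF assms(2)] by (simp add: arc_deriv_def)

lemma norm_unit_tangent: "t \<in> I \<Longrightarrow> norm (unit_tangent (\<gamma> t) x) = 1"
  using dx_nonzero[of t x] by (simp add: unit_tangent_def arc_deriv_def)

lemma dx_eq_speed_tangent: "t \<in> I \<Longrightarrow> dx (\<gamma> t) x = norm (dx (\<gamma> t) x) *\<^sub>R unit_tangent (\<gamma> t) x"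
  using dx_nonzero[of t x] by (simp add: unit_tangent_def arc_deriv_def)

lemma unit_tangent_has_derivative:
  assumes "t \<in> I"
  shows "(unit_tangent (\<gamma> t) has_vector_derivative norm (dx (\<gamma> t) x) *\<^sub>R curvature (\<gamma> t) x) (at x)"
  unfolding curvature_eq by (rule arc_deriv_has_derivative[OF tame_unit_tangent assms])

lemma inner_has_arc_derivative:
  assumes "tame I f" "tame I g" "t \<in> I"
  shows "((\<lambda>x. f t x \<bullet> g t x) has_vector_derivative norm (dx (\<gamma> t) x) *
    (f t x \<bullet> arc_deriv (\<gamma> t) (g t) x + arc_deriv (\<gamma> t) (f t) x \<bullet> g t x)) (at x)"
  using bounded_bilinear.has_vector_derivative[OF bounded_bilinear_inner
      arc_deriv_has_derivative[OF assms(1,3)] arc_deriv_has_derivative[OF assms(2,3)], of x]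
  by (simp add: algebra_simps)

lemma curvature_orthogonal:
  assumes "t \<in> I"
  shows "curvature (\<gamma> t) x \<bullet> unit_tangent (\<gamma> t) x = 0"
proof -
  let ?T = "unit_tangent (\<gamma> t)" and ?k = "curvature (\<gamma> t)"
  have "((\<lambda>x. ?T x \<bullet> ?T x) has_vector_derivative norm (dx (\<gamma> t) x) * (?T x \<bullet> ?k x + ?k x \<bullet> ?T x)) (at x)"
    using inner_has_arc_derivative[OF tame_unit_tangent tame_unit_tangent assms, of x] by (simp add: curvature_eq)
  moreover have "(\<lambda>x. ?T x \<bullet> ?T x) = (\<lambda>x. 1)"
    using norm_unit_tangent[OF assms] by (simp add: dot_square_norm)
  ultimately have "norm (dx (\<gamma> t) x) * (?T x \<bullet> ?k x + ?k x \<bullet> ?T x) = 0"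
    using vector_derivative_unique_at[OF _ has_vector_derivative_const] by metis
  then show ?thesis using dx_nonzero[OF assms, of x] by (simp add: inner_commute)
qed

text \<open>
  A velocity \<open>v\<close> decreases length up to boundary terms if \<open>\<langle>\<kappa>, v\<rangle>\<close> is a square modulo an arclength
  derivative: \<open>\<partial>\<^sub>s Q = \<bar>w\<bar>\<^sup>2 - \<langle>\<kappa>, v\<rangle>\<close>. The bound on the flux \<open>Q\<close> makes it vanish wherever the
  curvature does.
\<close>

definition gradient_velocity ::
  "(real \<Rightarrow> real \<Rightarrow> 'a) \<Rightarrow> (real \<Rightarrow> real \<Rightarrow> real) \<Rightarrow> (real \<Rightarrow> real \<Rightarrow> 'a) \<Rightarrow> bool"
  where "gradient_velocity v Q w \<longleftrightarrow> tame I v \<and> tame I Q \<and> tame I w \<and>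
    (\<forall>t\<in>I. \<forall>x. (Q t has_vector_derivative norm (dx (\<gamma> t) x) *
      (w t x \<bullet> w t x - curvature (\<gamma> t) x \<bullet> v t x)) (at x)) \<and>
    (\<forall>t\<in>I. \<forall>x. \<bar>Q t x\<bar> \<le> norm (curvature (\<gamma> t) x) * norm (w t x))"

text \<open>
  The dissipated quantity \<open>w\<close> is \<open>\<kappa>\<close> for curve shortening, \<open>\<nabla>\<^sub>s \<kappa>\<close> for surface diffusion and
  \<open>\<partial>\<^sub>s \<kappa>\<close> for Chen's flow. In the two flows of fourth order one integration by parts with
  \<open>Q = \<langle>\<kappa>, w\<rangle>\<close> suffices, since \<open>\<nabla>\<^sub>s\<close> and \<open>\<partial>\<^sub>s\<close> agree when paired with a normal field. There
  \<open>\<partial>\<^sub>s \<bar>\<kappa>\<bar>\<^sup>2 = 2 \<langle>\<kappa>, w\<rangle>\<close>, so a curve on which \<open>w\<close> vanishes has curvature of constant length.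
\<close>

lemma velocity_is_gradient:
  assumes V: "V \<in> {curve_shortening, surface_diffusion, chen}"
  obtains Q :: "real \<Rightarrow> real \<Rightarrow> real" and w :: "real \<Rightarrow> real \<Rightarrow> 'a"
  where "gradient_velocity (\<lambda>t. V (\<gamma> t)) Q w"
    and "\<And>t x y. t \<in> I \<Longrightarrow> \<forall>x. w t x = 0 \<Longrightarrow> norm (curvature (\<gamma> t) x) = norm (curvature (\<gamma> t) y)"
proof -
  let ?k = "\<lambda>t. curvature (\<gamma> t)"
  have const: "norm (?k t x) = norm (?k t y)"
    if "t \<in> I" "\<And>x. ?k t x \<bullet> arc_deriv (\<gamma> t) (?k t) x = 0" for t x y
  proof -
    have "((\<lambda>x. ?k t x \<bullet> ?k t x) has_real_derivative 0) (at x)" for x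
      using inner_has_arc_derivative[OF tame_curvature tame_curvature that(1), of x] that(2)[of x]
      by (simp add: inner_commute has_real_derivative_iff_has_vector_derivative)
    then have "?k t x \<bullet> ?k t x = ?k t y \<bullet> ?k t y"
      using DERIV_isconst_all by blast
    then show ?thesis by (simp add: norm_eq_sqrt_inner)
  qed
  consider "V = curve_shortening" | "V = surface_diffusion" | "V = chen" using V by blast
  then show ?thesis
  proof cases
    case 1
    have "curve_shortening = (curvature :: 'a velocity)" by (simp add: curve_shortening_def fun_eq_iff)
    with 1 show ?thesis
      by (intro that[of "\<lambda>t x. 0" ?k]) (auto simp: gradient_velocity_def intro: tame_const tame_curvature)
  next
    case 2
    define w where "w t = normal_deriv (\<gamma> t) (?k t)" for t
    define u where "u t = normal_deriv (\<gamma> t) (w t)" for t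
    have tw: "tame I w" unfolding w_def by (rule tame_normal_deriv[OF tame_curvature])
    have tu: "tame I u" unfolding u_def by (rule tame_normal_deriv[OF tw])
    have V: "V (\<gamma> t) x = - u t x" for t x
      by (simp add: 2 surface_diffusion_def eval_nat_numeral u_def w_def)
    have wT: "w t x \<bullet> unit_tangent (\<gamma> t) x = 0" if "t \<in> I" for t x
      using norm_unit_tangent[OF that, of x]
      by (simp add: w_def normal_deriv_def inner_diff_left dot_square_norm)
    show ?thesis
    proof (rule that[of "\<lambda>t x. ?k t x \<bullet> w t x" w])
      have flux: "((\<lambda>x. ?k t x \<bullet> w t x) has_vector_derivative norm (dx (\<gamma> t) x) *
        (w t x \<bullet> w t x - ?k t x \<bullet> V (\<gamma> t) x)) (at x)" if t: "t \<in> I" for t x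
      proof -
        have "?k t x \<bullet> arc_deriv (\<gamma> t) (w t) x = ?k t x \<bullet> u t x"
          using curvature_orthogonal[OF t, of x] by (simp add: u_def normal_deriv_def inner_diff_right)
        moreover have "arc_deriv (\<gamma> t) (?k t) x \<bullet> w t x = w t x \<bullet> w t x"
          using wT[OF t, of x] by (simp add: w_def normal_deriv_def inner_diff_left inner_diff_right inner_commute)
        ultimately show ?thesis
          using inner_has_arc_derivative[OF tame_curvature tw t, of x] by (simp add: V add.commute)
      qed
      have "tame I (\<lambda>t. V (\<gamma> t))" unfolding V by (rule tame_uminus[OF tu])
      with tw flux show "gradient_velocity (\<lambda>t. V (\<gamma> t)) (\<lambda>t x. ?k t x \<bullet> w t x) w"
        unfolding gradient_velocity_def by (intro conjI ballI allI tame_inner tame_curvature Cauchy_Schwarz_ineq2)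
      fix t assume t: "t \<in> I"
      show "norm (?k t x) = norm (?k t y)" if w0: "\<forall>x. w t x = 0" for x y
      proof (rule const[OF t])
        fix x
        have "arc_deriv (\<gamma> t) (?k t) x =
            (arc_deriv (\<gamma> t) (?k t) x \<bullet> unit_tangent (\<gamma> t) x) *\<^sub>R unit_tangent (\<gamma> t) x"
          using w0 by (simp add: w_def normal_deriv_def)
        then show "?k t x \<bullet> arc_deriv (\<gamma> t) (?k t) x = 0"
          using curvature_orthogonal[OF t, of x] by (metis inner_scaleR_right mult_zero_right)
      qed
    qed
  next
    case 3
    define w where "w t = arc_deriv (\<gamma> t) (?k t)" for t
    define u where "u t = arc_deriv (\<gamma> t) (w t)" for t
    have tw: "tame I w" unfolding w_def by (rule tame_arc_deriv[OF tame_dx[OF tame_curvature]])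
    have tu: "tame I u" unfolding u_def by (rule tame_arc_deriv[OF tame_dx[OF tw]])
    have V: "V (\<gamma> t) x = - u t x" for t x
      by (simp add: 3 chen_def eval_nat_numeral u_def w_def curvature_def)
    show ?thesis
    proof (rule that[of "\<lambda>t x. ?k t x \<bullet> w t x" w])
      have flux: "((\<lambda>x. ?k t x \<bullet> w t x) has_vector_derivative norm (dx (\<gamma> t) x) *
        (w t x \<bullet> w t x - ?k t x \<bullet> V (\<gamma> t) x)) (at x)" if t: "t \<in> I" for t x
        using inner_has_arc_derivative[OF tame_curvature tw t, of x]
        by (simp add: V add.commute u_def w_def)
      have "tame I (\<lambda>t. V (\<gamma> t))" unfolding V by (rule tame_uminus[OF tu])
      with tw flux show "gradient_velocity (\<lambda>t. V (\<gamma> t)) (\<lambda>t x. ?k t x \<bullet> w t x) w"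
        unfolding gradient_velocity_def by (intro conjI ballI allI tame_inner tame_curvature Cauchy_Schwarz_ineq2)
      fix t assume t: "t \<in> I"
      show "norm (?k t x) = norm (?k t y)" if w0: "\<forall>x. w t x = 0" for x y
        by (rule const[OF t]) (use w0 in \<open>simp add: w_def\<close>)
    qed
  qed
qed

end

section \<open>Direction energy and the ends of a curve of finite energy\<close>

text \<open>
  Some interval almost exhausts the supremum of the integrals over all intervals, and an interval
  disjoint from it can only carry the remainder.
\<close>

lemma integral_has_no_tail:
  fixes h :: "real \<Rightarrow> real"
  assumes cont: "continuous_on UNIV h" and nn: "\<And>x. 0 \<le> h x"
    and M: "\<And>a b. a \<le> b \<Longrightarrow> integral {a..b} h \<le> M" and "\<eta> > 0" "\<delta> > 0"
  shows "eventually (\<lambda>x. integral {x..x + \<delta>} h < \<eta>) at_infinity"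
proof -
  have int: "h integrable_on {a..b}" for a b
    by (intro integrable_continuous_real continuous_on_subset[OF cont]) auto
  have ge0: "integral {a..b} h \<ge> 0" for a b by (intro integral_nonneg int nn)
  have split: "integral {a..b} h + integral {b..c} h = integral {a..c} h" if "a \<le> b" "b \<le> c" for a b c
    using that by (intro Henstock_Kurzweil_Integration.integral_combine int)
  define A where "A = {integral {a..b} h | a b. a \<le> b}"
  have bdd: "bdd_above A" unfolding A_def bdd_above_def using M by auto
  have "A \<noteq> {}" unfolding A_def by blast
  then obtain y where "y \<in> A" "Sup A - \<eta> < y"
    using less_cSup_iff[OF _ bdd, of "Sup A - \<eta>"] \<open>\<eta> > 0\<close> by auto
  then obtain a b where ab: "a \<le> b" "Sup A - \<eta> < integral {a..b} h" unfolding A_def by auto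
  have Sup: "integral {c..d} h \<le> Sup A" if "c \<le> d" for c d
    using cSup_upper[OF _ bdd] that unfolding A_def by blast
  show ?thesis unfolding eventually_at_infinity
  proof (intro exI allI impI)
    fix x :: real assume x: "norm x \<ge> max \<bar>a\<bar> \<bar>b\<bar> + \<delta>"
    then consider "x \<ge> b" | "x + \<delta> \<le> a" using \<open>\<delta> > 0\<close> by (fastforce simp: abs_if split: if_splits)
    then show "integral {x..x + \<delta>} h < \<eta>"
    proof cases
      case 1
      then have "integral {a..b} h + integral {b..x} h + integral {x..x + \<delta>} h \<le> Sup A"
        using ab \<open>\<delta> > 0\<close> Sup[of a "x + \<delta>"] split[of a b x] split[of a x "x + \<delta>"] by simp
      with ab ge0[of b x] show ?thesis by linarith
    next
      case 2
      then have "integral {x..x + \<delta>} h + integral {x + \<delta>..a} h + integral {a..b} h \<le> Sup A"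
        using ab \<open>\<delta> > 0\<close> Sup[of x b] split[of x "x + \<delta>" a] split[of x a b] by simp
      with ab ge0[of "x + \<delta>" a] show ?thesis by linarith
    qed
  qed
qed

text \<open>
  Barbalat's lemma: a Lipschitz function that is not small at a point is not small on a
  neighbourhood of fixed length, and so contributes a fixed amount to the integral.
\<close>

lemma lipschitz_integrable_tendsto_0:
  fixes h :: "real \<Rightarrow> real"
  assumes h': "\<And>x. (h has_real_derivative h' x) (at x)" and K: "\<And>x. \<bar>h' x\<bar> \<le> K"
    and nn: "\<And>x. 0 \<le> h x" and M: "\<And>a b. a \<le> b \<Longrightarrow> integral {a..b} h \<le> M"
  shows "(h \<longlongrightarrow> 0) at_infinity"
proof (rule tendstoI)
  fix \<epsilon> :: real assume "\<epsilon> > 0"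
  have K0: "K \<ge> 0" using K[of 0] by linarith
  \<comment> \<open>\<open>K + 1\<close> instead of \<open>K\<close> covers \<open>K = 0\<close>\<close>
  define \<delta> where "\<delta> = \<epsilon> / (2 * (K + 1))"
  have \<delta>: "\<delta> > 0" "K * \<delta> \<le> \<epsilon> / 2"
    using \<open>\<epsilon> > 0\<close> K0 by (auto simp: \<delta>_def field_simps)
  have cont: "continuous_on UNIV h"
    using h' by (meson DERIV_continuous_on has_field_derivative_at_within)
  have "eventually (\<lambda>x. integral {x..x + \<delta>} h < \<delta> * (\<epsilon> / 2)) at_infinity"
    using integral_has_no_tail[OF cont nn M, of "\<delta> * (\<epsilon> / 2)" \<delta>] \<delta>(1) \<open>\<epsilon> > 0\<close> by simp
  then show "eventually (\<lambda>x. dist (h x) 0 < \<epsilon>) at_infinity"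
  proof (rule eventually_mono)
    fix x assume x: "integral {x..x + \<delta>} h < \<delta> * (\<epsilon> / 2)"
    have "h x - K * \<delta> \<le> h y" if "y \<in> {x..x + \<delta>}" for y
    proof -
      have "norm (h y - h x) \<le> K * norm (y - x)"
        by (rule field_differentiable_bound[where S = UNIV and f' = h']) (use h' K in auto)
      also have "\<dots> \<le> K * \<delta>" using that K0 by (intro mult_left_mono) auto
      finally show ?thesis by (simp add: abs_le_iff)
    qed
    then have "integral {x..x + \<delta>} (\<lambda>_. h x - K * \<delta>) \<le> integral {x..x + \<delta>} h"
      by (intro integral_le integrable_continuous_real continuous_on_subset[OF cont]) auto
    then have "\<delta> * (h x - K * \<delta>) \<le> integral {x..x + \<delta>} h" using \<delta>(1) by simp
    then have "\<delta> * (h x - K * \<delta>) < \<delta> * (\<epsilon> / 2)" using x by linarith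
    then have "h x - K * \<delta> < \<epsilon> / 2" using \<delta>(1) by (simp only: mult_less_cancel_left_pos)
    then have "h x < \<epsilon>" using \<delta>(2) by linarith
    then show "dist (h x) 0 < \<epsilon>" using nn[of x] by simp
  qed
qed

text \<open>
  The first-order Taylor estimate \<open>\<delta> \<bar>f' x\<bar> \<le> \<bar>f (x + \<delta>) - f x\<bar> + K \<delta>\<^sup>2\<close> bounds \<open>f'\<close> far out by
  \<open>K \<delta>\<close> plus a term that tends to zero, for every step \<open>\<delta>\<close>.
\<close>

lemma derivative_tendsto_0:
  fixes f :: "real \<Rightarrow> 'a::real_normed_vector"
  assumes f': "\<And>x. (f has_vector_derivative f' x) (at x)"
    and f'': "\<And>x. (f' has_vector_derivative f'' x) (at x)" and K: "\<And>x. norm (f'' x) \<le> K"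
    and lim: "(f \<longlongrightarrow> l) at_infinity"
  shows "(f' \<longlongrightarrow> 0) at_infinity"
proof (rule tendstoI)
  fix \<epsilon> :: real assume "\<epsilon> > 0"
  have K0: "K \<ge> 0" using K[of 0] norm_ge_zero order_trans by blast
  \<comment> \<open>\<open>K + 1\<close> instead of \<open>K\<close> covers \<open>K = 0\<close>\<close>
  define \<delta> where "\<delta> = \<epsilon> / (2 * (K + 1))"
  have \<delta>: "\<delta> > 0" "K * \<delta> \<le> \<epsilon> / 2"
    using \<open>\<epsilon> > 0\<close> K0 by (auto simp: \<delta>_def field_simps)
  have "filterlim (\<lambda>x. \<delta> + x) at_infinity at_infinity"
    by (rule tendsto_add_filterlim_at_infinity[OF tendsto_const filterlim_ident])
  from tendsto_diff[OF filterlim_compose[OF lim this] lim]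
  have "((\<lambda>x. f (\<delta> + x) - f x) \<longlongrightarrow> 0) at_infinity" by simp
  then have "eventually (\<lambda>x. dist (f (\<delta> + x) - f x) 0 < \<delta> * (\<epsilon> / 2)) at_infinity"
    using \<delta>(1) \<open>\<epsilon> > 0\<close> by (intro tendstoD) auto
  then show "eventually (\<lambda>x. dist (f' x) 0 < \<epsilon>) at_infinity"
  proof (rule eventually_mono)
    fix x assume x: "dist (f (\<delta> + x) - f x) 0 < \<delta> * (\<epsilon> / 2)"
    have "norm (f (\<delta> + x) - f x - (\<delta> + x - x) *\<^sub>R f' x) \<le> norm (\<delta> + x - x) * (K * \<delta>)"
    proof (rule vector_differentiable_bound_linearization[where S = "{x..\<delta> + x}"])
      show "(f has_vector_derivative f' y) (at y within {x..\<delta> + x})" for y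
        by (rule has_vector_derivative_at_within[OF f'])
      show "norm (f' y - f' x) \<le> K * \<delta>" if "y \<in> {x..\<delta> + x}" for y
      proof -
        have "norm (f' y - f' x) \<le> K * norm (y - x)"
          by (rule differentiable_bound[where S = UNIV and f' = "\<lambda>x h. h *\<^sub>R f'' x"])
            (use f'' K in \<open>auto simp: has_vector_derivative_def onorm_scaleR_left onorm_id\<close>)
        also have "\<dots> \<le> K * \<delta>" using that K0 by (intro mult_left_mono) auto
        finally show ?thesis .
      qed
    qed (use \<delta> in \<open>auto simp: closed_segment_eq_real_ivl\<close>)
    then have "norm (\<delta> *\<^sub>R f' x) \<le> norm (f (\<delta> + x) - f x) + \<delta> * (K * \<delta>)"
      using norm_triangle_ineq2[of "\<delta> *\<^sub>R f' x" "f (\<delta> + x) - f x"] \<delta>(1)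
      by (simp add: norm_minus_commute)
    also have "\<dots> < \<delta> * (\<epsilon> / 2) + \<delta> * (\<epsilon> / 2)"
      using x \<delta> by (intro add_less_le_mono mult_left_mono) auto
    also have "\<dots> = \<delta> * \<epsilon>" by simp
    finally show "dist (f' x) 0 < \<epsilon>" using \<delta>(1) by simp
  qed
qed

text \<open>
  The length of an arc minus its displacement in the direction \<open>e\<close>. As
  \<open>\<bar>T - e\<bar>\<^sup>2 = 2 - 2 \<langle>T, e\<rangle>\<close> for unit vectors, this is the direction energy of the arc; in this form
  it is linear in \<open>e\<close> and easy to differentiate.
\<close>

definition energy_on :: "'a::real_inner \<Rightarrow> (real \<Rightarrow> 'a) \<Rightarrow> real \<Rightarrow> real \<Rightarrow> real"
  where "energy_on e c a b = integral {a..b} (\<lambda>x. norm (dx c x) - dx c x \<bullet> e)"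

lemma energy_density_nonneg:
  fixes v e :: "'a::real_inner"
  assumes "norm e = 1"
  shows "0 \<le> norm v - v \<bullet> e"
  using norm_cauchy_schwarz[of v e] assms by simp

lemma norm_diff_unit:
  fixes u e :: "'a::real_inner"
  assumes "norm u = 1" "norm e = 1"
  shows "(norm (u - e))\<^sup>2 = 2 - 2 * (u \<bullet> e)"
  using dot_norm_neg[of u e] assms by simp

lemma direction_energy_bound:
  fixes c :: "real \<Rightarrow> 'a::euclidean_space"
  assumes e: "norm e = 1" and fin: "direction_energy e c < \<infinity>"
    and cont: "continuous_on UNIV (dx c)" and nz: "\<And>x. dx c x \<noteq> 0"
  obtains M where "\<And>a b. a \<le> b \<Longrightarrow> energy_on e c a b \<le> M"
proof -
  let ?h = "\<lambda>x. norm (dx c x) - dx c x \<bullet> e"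
  have density: "(norm (unit_tangent c x - e))\<^sup>2 * norm (dx c x) = 2 * ?h x" for x
  proof -
    have "(norm (unit_tangent c x - e))\<^sup>2 = 2 - 2 * (unit_tangent c x \<bullet> e)"
      using nz[of x] by (intro norm_diff_unit e) (simp add: unit_tangent_def arc_deriv_def)
    moreover have "(2 - 2 * (unit_tangent c x \<bullet> e)) * norm (dx c x) = 2 * ?h x"
      using nz[of x] by (simp add: unit_tangent_def arc_deriv_def field_simps)
    ultimately show ?thesis by simp
  qed
  have cont_h: "continuous_on A ?h" for A
    by (intro continuous_intros continuous_on_subset[OF cont]) auto
  let ?N = "\<integral>\<^sup>+ x. ennreal (2 * ?h x) \<partial>lborel"
  have N: "?N < \<infinity>"
    using fin unfolding direction_energy_def density by (auto simp: ennreal_divide_eq_top_iff less_top[symmetric] top_unique)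
  have "energy_on e c a b \<le> enn2real ?N" if "a \<le> b" for a b
  proof -
    have "(?h has_integral energy_on e c a b) {a..b}"
      unfolding energy_on_def by (intro integrable_integral integrable_continuous_real cont_h)
    from nn_integral_has_integral_lebesgue'[OF energy_density_nonneg[OF e] this]
    have "ennreal (energy_on e c a b) = (\<integral>\<^sup>+ x. ennreal (?h x) * indicator {a..b} x \<partial>lborel)" by simp
    also have "\<dots> \<le> ?N"
      using energy_density_nonneg[OF e] by (intro nn_integral_mono) (auto simp: indicator_def intro!: ennreal_leI)
    finally have "enn2real (ennreal (energy_on e c a b)) \<le> enn2real ?N"
      using N by (intro enn2real_mono) auto
    moreover have "0 \<le> energy_on e c a b"
      unfolding energy_on_def
      by (intro Henstock_Kurzweil_Integration.integral_nonneg integrable_continuous_real cont_h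
          energy_density_nonneg[OF e])
    ultimately show ?thesis by simp
  qed
  then show ?thesis using that by blast
qed

context curve_family
begin

lemma energy_density_eq:
  assumes "t \<in> I"
  shows "norm (dx (\<gamma> t) x) - dx (\<gamma> t) x \<bullet> e = dx (\<gamma> t) x \<bullet> (unit_tangent (\<gamma> t) x - e)"
  using dx_nonzero[OF assms, of x]
  by (simp add: inner_diff_right unit_tangent_def arc_deriv_def dot_square_norm power2_eq_square)

text \<open>
  The energy density is Lipschitz and has bounded integrals, so it tends to zero, and it controls
  \<open>\<bar>T - e\<bar>\<^sup>2\<close> through the lower bound on the speed. Convergence of \<open>T\<close> passes to its derivative
  because the second derivative of \<open>T\<close> is bounded.
\<close>

lemma straight_ends:
  assumes t: "t \<in> I" and e: "norm e = 1" and M: "\<And>a b. a \<le> b \<Longrightarrow> energy_on e (\<gamma> t) a b \<le> M"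
  shows "(unit_tangent (\<gamma> t) \<longlongrightarrow> e) at_infinity" "(curvature (\<gamma> t) \<longlongrightarrow> 0) at_infinity"
proof -
  let ?T = "unit_tangent (\<gamma> t)"
  define h where "h t x = dx (\<gamma> t) x \<bullet> (unit_tangent (\<gamma> t) x - e)" for t x
  have th: "tame I h"
    unfolding h_def by (intro tame_inner tame_velocity tame_diff tame_unit_tangent tame_const)
  have h_eq: "h t x = norm (dx (\<gamma> t) x) - dx (\<gamma> t) x \<bullet> e" for x
    using energy_density_eq[OF t, of x e] by (simp add: h_def)
  obtain K where K: "\<And>x. \<bar>dx (h t) x\<bar> \<le> K"
    using bounded_cont_bound[OF tame_bounded_cont[OF tame_dx[OF th]]] t by (metis real_norm_def)
  have h0: "(h t \<longlongrightarrow> 0) at_infinity"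
  proof (rule lipschitz_integrable_tendsto_0)
    show "(h t has_real_derivative dx (h t) x) (at x)" for x
      using tame_has_dx[OF th t] by (simp add: has_real_derivative_iff_has_vector_derivative)
    show "\<bar>dx (h t) x\<bar> \<le> K" for x by (rule K)
    show "0 \<le> h t x" for x unfolding h_eq by (rule energy_density_nonneg[OF e])
    show "integral {a..b} (h t) \<le> M" if "a \<le> b" for a b
      using M[OF that] by (simp add: energy_on_def h_eq[abs_def])
  qed
  have sq: "(norm (?T x - e))\<^sup>2 \<le> 2 / m * h t x" for x
  proof -
    have "(norm (?T x - e))\<^sup>2 = 2 - 2 * (?T x \<bullet> e)"
      by (rule norm_diff_unit[OF norm_unit_tangent[OF t] e])
    also have "\<dots> = 2 / norm (dx (\<gamma> t) x) * h t x"
      using dx_nonzero[OF t, of x] unfolding h_eq by (simp add: unit_tangent_def arc_deriv_def field_simps)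
    also have "\<dots> \<le> 2 / m * h t x"
      using speed_ge[OF t, of x] m_pos energy_density_nonneg[OF e] unfolding h_eq
      by (intro mult_right_mono divide_left_mono mult_pos_pos) auto
    finally show ?thesis .
  qed
  have "((\<lambda>x. (norm (?T x - e))\<^sup>2) \<longlongrightarrow> 0) at_infinity"
  proof (rule tendsto_sandwich[OF _ _ tendsto_const])
    show "((\<lambda>x. 2 / m * h t x) \<longlongrightarrow> 0) at_infinity" using tendsto_mult_left[OF h0, of "2/m"] by simp
  qed (use sq in auto)
  from tendsto_real_sqrt[OF this] have "((\<lambda>x. norm (?T x - e)) \<longlongrightarrow> 0) at_infinity" by simp
  then show T: "(?T \<longlongrightarrow> e) at_infinity"
    using LIM_zero_cancel tendsto_norm_zero_iff by blast
  have "tame I (\<lambda>t. dx (dx (unit_tangent (\<gamma> t))))" by (intro tame_dx tame_unit_tangent)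
  from bounded_cont_bound[OF tame_bounded_cont[OF this]] t
  obtain K' where K': "\<And>x. norm (dx (dx ?T) x) \<le> K'" by metis
  have T': "(dx ?T \<longlongrightarrow> 0) at_infinity"
    by (rule derivative_tendsto_0[OF tame_has_dx[OF tame_unit_tangent t]
          tame_has_dx[OF tame_dx[OF tame_unit_tangent] t] K' T])
  have "norm (curvature (\<gamma> t) x) \<le> 1 / m * norm (dx ?T x)" for x
  proof -
    have "1 / norm (dx (\<gamma> t) x) \<le> 1 / m"
      using speed_ge[OF t, of x] m_pos by (simp add: frac_le)
    then show ?thesis
      using mult_right_mono[of "1 / norm (dx (\<gamma> t) x)" "1 / m" "norm (dx ?T x)"]
      by (simp add: curvature_eq arc_deriv_def)
  qed
  then have "eventually (\<lambda>x. norm (curvature (\<gamma> t) x) \<le> 1 / m * norm (dx ?T x)) at_infinity"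
    by simp
  moreover have "((\<lambda>x. 1 / m * norm (dx ?T x)) \<longlongrightarrow> 0) at_infinity"
    using tendsto_mult_left[OF tendsto_norm[OF T'], of "1/m"] by simp
  ultimately show "(curvature (\<gamma> t) \<longlongrightarrow> 0) at_infinity"
    by (rule Lim_null_comparison)
qed

end

section \<open>First variation of the direction energy along a flow\<close>

text \<open>
  A smooth flow enters the first variation only through its velocity \<open>v\<close> and the mixed derivative
  \<open>v' = \<partial>\<^sub>t \<partial>\<^sub>x \<gamma>\<close>.
\<close>

locale evolution = curve_family "{0..\<tau>}" \<gamma> m
  for \<tau> :: real and \<gamma> :: "real \<Rightarrow> real \<Rightarrow> 'a::euclidean_space" and m +
  fixes v v' :: "real \<Rightarrow> real \<Rightarrow> 'a"
  assumes tau_pos: "0 < \<tau>"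
    and time_deriv: "t \<in> {0..\<tau>} \<Longrightarrow> ((\<lambda>s. \<gamma> s x) has_vector_derivative v t x) (at t within {0..\<tau>})"
    and mixed_deriv: "t \<in> {0..\<tau>} \<Longrightarrow>
      ((\<lambda>s. dx (\<gamma> s) x) has_vector_derivative v' t x) (at t within {0..\<tau>})"
    and continuous_mixed: "continuous_on ({0..\<tau>} \<times> UNIV) (\<lambda>(t, x). v' t x)"
begin

lemma continuous_slice:
  assumes "continuous_on ({0..\<tau>} \<times> UNIV) (\<lambda>(t, x). f t x)"
  shows "t \<in> {0..\<tau>} \<Longrightarrow> continuous_on A (\<lambda>x. f t x)" "continuous_on {0..\<tau>} (\<lambda>t. f t x)"
proof -
  show "continuous_on A (\<lambda>x. f t x)" if "t \<in> {0..\<tau>}"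
    using that by (auto intro: continuous_on_compose2[OF assms, of A "\<lambda>x. (t, x)", simplified] intro!: continuous_intros)
  show "continuous_on {0..\<tau>} (\<lambda>t. f t x)"
    by (auto intro: continuous_on_compose2[OF assms, of _ "\<lambda>t. (t, x)", simplified] intro!: continuous_intros)
qed

lemma continuous_tame:
  assumes "tame {0..\<tau>} f"
  shows "continuous_on ({0..\<tau>} \<times> UNIV) (\<lambda>(t, x). f t x)"
  using tame_bounded_cont[OF assms] by (simp add: bounded_cont_def)

text \<open>
  Mixed derivatives commute: differentiating \<open>\<gamma> s y - \<gamma> s a = \<integral>\<^sub>a\<^sup>y \<partial>\<^sub>x \<gamma>\<close> in time under the integral
  sign writes \<open>v\<close> as an indefinite integral of \<open>v'\<close>.
\<close>

lemma velocity_has_dx: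
  assumes t: "t \<in> {0..\<tau>}"
  shows "(v t has_vector_derivative v' t x) (at x)"
proof -
  define a b where "a = x - 1" and "b = x + 1"
  have increment: "v t y = v t a + integral {a..y} (v' t)" if "y \<in> {a..b}" for y
  proof -
    have "((\<lambda>s. integral (cbox a y) (dx (\<gamma> s))) has_vector_derivative integral (cbox a y) (v' t)) (at t within {0..\<tau>})"
    proof (rule leibniz_rule_vector_derivative)
      show "dx (\<gamma> s) integrable_on cbox a y" if "s \<in> {0..\<tau>}" for s
        using continuous_slice(1)[OF continuous_tame[OF tame_velocity] that] by (intro integrable_continuous)
      show "continuous_on ({0..\<tau>} \<times> cbox a y) (\<lambda>(t, x). v' t x)"
        by (rule continuous_on_subset[OF continuous_mixed]) auto
    qed (use mixed_deriv t in auto)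
    moreover have "\<gamma> s y - \<gamma> s a = integral (cbox a y) (dx (\<gamma> s))" if "s \<in> {0..\<tau>}" for s
      using fundamental_theorem_of_calculus[of a y "\<gamma> s" "dx (\<gamma> s)"] \<open>y \<in> {a..b}\<close> differentiable[OF that]
      by (simp add: has_vector_derivative_at_within integral_unique vector_derivative_works)
    ultimately have "((\<lambda>s. \<gamma> s y - \<gamma> s a) has_vector_derivative integral (cbox a y) (v' t)) (at t within {0..\<tau>})"
      by (rule has_vector_derivative_transform[OF t, rotated])
    moreover have "((\<lambda>s. \<gamma> s y - \<gamma> s a) has_vector_derivative (v t y - v t a)) (at t within {0..\<tau>})"
      by (intro has_vector_derivative_diff time_deriv t)
    ultimately have "integral (cbox a y) (v' t) = v t y - v t a"
      using vector_derivative_unique_within_closed_interval[of 0 \<tau> t] tau_pos t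
      by (metis box_real(2))
    then show ?thesis by simp
  qed
  have "((\<lambda>y. integral {a..y} (v' t)) has_vector_derivative v' t x) (at x within {a..b})"
    by (rule integral_has_vector_derivative[OF continuous_slice(1)[OF continuous_mixed t]])
      (simp add: a_def b_def)
  from has_vector_derivative_add[OF has_vector_derivative_const this]
  have "((\<lambda>y. v t a + integral {a..y} (v' t)) has_vector_derivative v' t x) (at x within {a..b})"
    by simp
  then have "(v t has_vector_derivative v' t x) (at x within {a..b})"
    by (rule has_vector_derivative_transform[OF _ increment, rotated 2]) (simp_all add: a_def b_def)
  moreover have "x \<in> interior {a..b}" by (simp add: a_def b_def)
  ultimately show ?thesis
    using at_within_interior[of x "{a..b}"] by simp
qed

end

locale gradient_evolution = evolution \<tau> \<gamma> m v v'
  for \<tau> :: real and \<gamma> :: "real \<Rightarrow> real \<Rightarrow> 'a::euclidean_space" and m v v' +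
  fixes Q :: "real \<Rightarrow> real \<Rightarrow> real" and w :: "real \<Rightarrow> real \<Rightarrow> 'a" and e :: 'a
  assumes norm_e: "norm e = 1"
    and gradient: "gradient_velocity v Q w"
begin

lemma
  shows tame_v: "tame {0..\<tau>} v" and tame_Q: "tame {0..\<tau>} Q" and tame_w: "tame {0..\<tau>} w"
    and flux_deriv: "t \<in> {0..\<tau>} \<Longrightarrow> (Q t has_vector_derivative norm (dx (\<gamma> t) x) *
      (w t x \<bullet> w t x - curvature (\<gamma> t) x \<bullet> v t x)) (at x)"
    and flux_bound: "t \<in> {0..\<tau>} \<Longrightarrow> \<bar>Q t x\<bar> \<le> norm (curvature (\<gamma> t) x) * norm (w t x)"
  using gradient unfolding gradient_velocity_def by auto

text \<open>
  Everything that the integrations by parts leave at an endpoint.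
\<close>

definition boundary :: "real \<Rightarrow> real \<Rightarrow> real"
  where "boundary t x = (unit_tangent (\<gamma> t) x - e) \<bullet> v t x + Q t x"

definition dissipation :: "real \<Rightarrow> real \<Rightarrow> real"
  where "dissipation t x = (w t x \<bullet> w t x) * norm (dx (\<gamma> t) x)"

lemma tame_boundary: "tame {0..\<tau>} boundary"
  unfolding boundary_def
  by (intro tame_add tame_inner tame_diff tame_unit_tangent tame_const tame_v tame_Q)

lemma continuous_dissipation: "continuous_on ({0..\<tau>} \<times> UNIV) (\<lambda>(t, x). dissipation t x)"
  using continuous_tame[OF tame_w] continuous_tame[OF tame_velocity]
  unfolding dissipation_def case_prod_unfold by (intro continuous_intros)

lemma dissipation_nonneg: "dissipation t x \<ge> 0"
  by (simp add: dissipation_def)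

lemma boundary_deriv:
  assumes t: "t \<in> {0..\<tau>}"
  shows "(boundary t has_vector_derivative
    (unit_tangent (\<gamma> t) x - e) \<bullet> v' t x + dissipation t x) (at x)"
proof -
  have "((\<lambda>x. unit_tangent (\<gamma> t) x - e) has_vector_derivative norm (dx (\<gamma> t) x) *\<^sub>R curvature (\<gamma> t) x) (at x)"
    using unit_tangent_has_derivative[OF t, of x] by (auto intro!: derivative_eq_intros)
  from has_vector_derivative_add[OF bounded_bilinear.has_vector_derivative[OF bounded_bilinear_inner this
        velocity_has_dx[OF t]] flux_deriv[OF t]]
  show ?thesis by (simp add: boundary_def[abs_def] dissipation_def algebra_simps)
qed

lemma continuous_density:
  assumes "t \<in> {0..\<tau>}"
  shows "continuous_on A (\<lambda>x. norm (dx (\<gamma> t) x) - dx (\<gamma> t) x \<bullet> e)"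
  using continuous_slice(1)[OF continuous_tame[OF tame_velocity] assms]
  by (intro continuous_intros)

text \<open>
  The density varies with rate \<open>\<langle>T - e, \<partial>\<^sub>x v\<rangle>\<close>, which is \<open>\<partial>\<^sub>x\<close> of the boundary term minus the
  dissipation: this is the integration by parts that moves \<open>\<partial>\<^sub>x\<close> from \<open>v\<close> to \<open>T - e\<close>, combined
  with the one hidden in the flux \<open>Q\<close>.
\<close>

lemma energy_deriv:
  assumes t: "t \<in> {0..\<tau>}" and "a \<le> b"
  shows "((\<lambda>s. energy_on e (\<gamma> s) a b) has_vector_derivative
    (boundary t b - boundary t a) - integral {a..b} (dissipation t)) (at t within {0..\<tau>})"
proof -
  let ?g = "\<lambda>t x. (unit_tangent (\<gamma> t) x - e) \<bullet> v' t x"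
  have "((\<lambda>s. integral (cbox a b) (\<lambda>x. norm (dx (\<gamma> s) x) - dx (\<gamma> s) x \<bullet> e)) has_vector_derivative
    integral (cbox a b) (?g t)) (at t within {0..\<tau>})"
  proof (rule leibniz_rule_vector_derivative)
    fix s x assume s: "s \<in> {0..\<tau>}"
    have "((\<lambda>s. dx (\<gamma> s) x \<bullet> e) has_vector_derivative v' s x \<bullet> e) (at s within {0..\<tau>})"
      using bounded_linear.has_vector_derivative[OF bounded_linear_inner_left mixed_deriv[OF s]] .
    from has_vector_derivative_diff[OF norm_has_vector_derivative[OF mixed_deriv[OF s, of x] dx_nonzero[OF s]] this]
    show "((\<lambda>s. norm (dx (\<gamma> s) x) - dx (\<gamma> s) x \<bullet> e) has_vector_derivative ?g s x) (at s within {0..\<tau>})"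
      by (simp add: unit_tangent_def arc_deriv_def inner_diff_left inner_commute[of e])
  next
    show "(\<lambda>x. norm (dx (\<gamma> s) x) - dx (\<gamma> s) x \<bullet> e) integrable_on cbox a b" if "s \<in> {0..\<tau>}" for s
      by (rule integrable_continuous[OF continuous_density[OF that]])
    show "continuous_on ({0..\<tau>} \<times> cbox a b) (\<lambda>(t, x). ?g t x)"
      using continuous_mixed continuous_tame[OF tame_unit_tangent]
      unfolding case_prod_unfold
      by (intro continuous_intros) (auto elim!: continuous_on_subset)
  qed (use t in auto)
  moreover have "(?g t has_integral (boundary t b - boundary t a) - integral {a..b} (dissipation t)) {a..b}"
  proof -
    have "((\<lambda>x. ?g t x + dissipation t x) has_integral boundary t b - boundary t a) {a..b}"
      by (rule fundamental_theorem_of_calculus[OF \<open>a \<le> b\<close>])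
        (rule has_vector_derivative_at_within[OF boundary_deriv[OF t]])
    moreover have "(dissipation t has_integral integral {a..b} (dissipation t)) {a..b}"
      by (intro integrable_integral integrable_continuous_real continuous_slice(1)[OF continuous_dissipation t])
    ultimately have "((\<lambda>x. ?g t x + dissipation t x - dissipation t x) has_integral
      (boundary t b - boundary t a) - integral {a..b} (dissipation t)) {a..b}"
      by (rule has_integral_diff)
    then show ?thesis by simp
  qed
  ultimately show ?thesis by (simp add: energy_on_def integral_unique)
qed

lemma continuous_dissipation_integral:
  "continuous_on {0..\<tau>} (\<lambda>s. integral {a..b} (dissipation s))"
  using integral_continuous_on_param[of "{0..\<tau>}" a b dissipation]
    continuous_on_subset[OF continuous_dissipation, of "{0..\<tau>} \<times> {a..b}"] by auto

lemma energy_balance: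
  assumes t: "t \<in> {0..\<tau>}" and "a \<le> b"
  shows "energy_on e (\<gamma> t) a b - energy_on e (\<gamma> 0) a b =
    integral {0..t} (\<lambda>s. boundary s b - boundary s a) - integral {0..t} (\<lambda>s. integral {a..b} (dissipation s))"
proof -
  have sub: "{0..t} \<subseteq> {0..\<tau>}" using t by auto
  have "((\<lambda>s. (boundary s b - boundary s a) - integral {a..b} (dissipation s)) has_integral
    energy_on e (\<gamma> t) a b - energy_on e (\<gamma> 0) a b) {0..t}"
  proof (rule fundamental_theorem_of_calculus)
    show "((\<lambda>s. energy_on e (\<gamma> s) a b) has_vector_derivative
      (boundary s b - boundary s a) - integral {a..b} (dissipation s)) (at s within {0..t})"
      if "s \<in> {0..t}" for s
      using that sub by (intro has_vector_derivative_within_subset[OF energy_deriv[OF _ \<open>a \<le> b\<close>] sub]) auto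
  qed (use t in auto)
  moreover have "(\<lambda>s. boundary s b - boundary s a) integrable_on {0..t}"
    by (intro integrable_continuous_real continuous_on_subset[OF _ sub] continuous_intros
        continuous_slice(2)[OF continuous_tame[OF tame_boundary]])
  moreover have "(\<lambda>s. integral {a..b} (dissipation s)) integrable_on {0..t}"
    by (intro integrable_continuous_real continuous_on_subset[OF continuous_dissipation_integral sub])
  ultimately show ?thesis
    using integral_diff[of "\<lambda>s. boundary s b - boundary s a" "{0..t}" "\<lambda>s. integral {a..b} (dissipation s)"]
    by (simp add: integral_unique)
qed

end

section \<open>Vanishing of the boundary terms\<close>

context gradient_evolution
begin

lemma energy_on_mono:
  assumes t: "t \<in> {0..\<tau>}" and "c \<le> a" "b \<le> d"
  shows "energy_on e (\<gamma> t) a b \<le> energy_on e (\<gamma> t) c d"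
  unfolding energy_on_def
  by (rule integral_subset_le)
    (use assms energy_density_nonneg[OF norm_e] in \<open>auto intro!: integrable_continuous_real continuous_density\<close>)

lemma dissipation_integral_mono:
  assumes s: "s \<in> {0..\<tau>}" and "c \<le> a" "b \<le> d"
  shows "integral {a..b} (dissipation s) \<le> integral {c..d} (dissipation s)"
  by (rule integral_subset_le)
    (use assms in \<open>auto intro!: integrable_continuous_real continuous_slice(1)[OF continuous_dissipation] dissipation_nonneg\<close>)

lemma dissipation_integral_nonneg: "s \<in> {0..\<tau>} \<Longrightarrow> 0 \<le> integral {a..b} (dissipation s)"
  by (intro Henstock_Kurzweil_Integration.integral_nonneg integrable_continuous_real
      continuous_slice(1)[OF continuous_dissipation] dissipation_nonneg)

text \<open>
  Boundary terms are bounded uniformly in time and space, so on every interval, however long, the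
  energy grows at most linearly in time with one and the same rate.
\<close>

lemma energy_stays_bounded:
  assumes M: "\<And>a b. a \<le> b \<Longrightarrow> energy_on e (\<gamma> 0) a b \<le> M"
  obtains M' where "\<And>t a b. t \<in> {0..\<tau>} \<Longrightarrow> a \<le> b \<Longrightarrow> energy_on e (\<gamma> t) a b \<le> M'"
proof -
  obtain B where B: "B > 0" "\<And>t x. t \<in> {0..\<tau>} \<Longrightarrow> norm (boundary t x) \<le> B"
    using bounded_cont_bound[OF tame_bounded_cont[OF tame_boundary]] by blast
  have "energy_on e (\<gamma> t) a b \<le> M + (2 * B) * \<tau>" if t: "t \<in> {0..\<tau>}" and "a \<le> b" for t a b
  proof -
    have sub: "{0..t} \<subseteq> {0..\<tau>}" using t by auto
    have "integral {0..t} (\<lambda>s. boundary s b - boundary s a) \<le> integral {0..t} (\<lambda>s. 2 * B)"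
    proof (rule integral_le)
      show "(\<lambda>s. boundary s b - boundary s a) integrable_on {0..t}"
        by (intro integrable_continuous_real continuous_on_subset[OF _ sub] continuous_intros
          continuous_slice(2)[OF continuous_tame[OF tame_boundary]])
      show "boundary s b - boundary s a \<le> 2 * B" if "s \<in> {0..t}" for s
        using B(2)[of s a] B(2)[of s b] that sub by (auto simp: abs_le_iff)
    qed auto
    also have "\<dots> \<le> 2 * B * \<tau>" using t B(1) by auto
    finally have "integral {0..t} (\<lambda>s. boundary s b - boundary s a) \<le> 2 * B * \<tau>" .
    moreover have "0 \<le> integral {0..t} (\<lambda>s. integral {a..b} (dissipation s))"
      using sub by (intro Henstock_Kurzweil_Integration.integral_nonneg dissipation_integral_nonneg
        integrable_continuous_real continuous_on_subset[OF continuous_dissipation_integral]) auto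
    ultimately show ?thesis using energy_balance[OF t \<open>a \<le> b\<close>] M[OF \<open>a \<le> b\<close>] by linarith
  qed
  then show ?thesis using that by blast
qed

text \<open>
  Finite energy straightens the ends: \<open>T - e\<close> kills the first boundary term and \<open>\<kappa>\<close> kills the
  flux.
\<close>

lemma boundary_vanishes:
  assumes t: "t \<in> {0..\<tau>}" and M: "\<And>a b. a \<le> b \<Longrightarrow> energy_on e (\<gamma> t) a b \<le> M"
  shows "(boundary t \<longlongrightarrow> 0) at_infinity"
proof -
  obtain A where A: "A > 0" "\<And>x. norm (v t x) \<le> A"
    using bounded_cont_bound[OF tame_bounded_cont[OF tame_v]] t by metis
  obtain B where B: "B > 0" "\<And>x. norm (w t x) \<le> B"
    using bounded_cont_bound[OF tame_bounded_cont[OF tame_w]] t by metis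
  note ends = straight_ends[OF t norm_e M]
  have "((\<lambda>x. norm (unit_tangent (\<gamma> t) x - e) * A + norm (curvature (\<gamma> t) x) * B) \<longlongrightarrow>
      norm (e - e) * A + norm (0::'a) * B) at_infinity"
    by (intro tendsto_intros ends)
  then have lim: "((\<lambda>x. norm (unit_tangent (\<gamma> t) x - e) * A + norm (curvature (\<gamma> t) x) * B) \<longlongrightarrow> 0) at_infinity"
    by simp
  have "norm (boundary t x) \<le> norm (unit_tangent (\<gamma> t) x - e) * A + norm (curvature (\<gamma> t) x) * B" for x
  proof -
    have "norm (boundary t x) \<le> \<bar>(unit_tangent (\<gamma> t) x - e) \<bullet> v t x\<bar> + \<bar>Q t x\<bar>"
      unfolding boundary_def by (simp add: abs_triangle_ineq)
    also have "\<dots> \<le> norm (unit_tangent (\<gamma> t) x - e) * norm (v t x) + norm (curvature (\<gamma> t) x) * norm (w t x)"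
      by (intro add_mono Cauchy_Schwarz_ineq2 flux_bound t)
    also have "\<dots> \<le> norm (unit_tangent (\<gamma> t) x - e) * A + norm (curvature (\<gamma> t) x) * B"
      by (intro add_mono mult_left_mono A B) auto
    finally show ?thesis .
  qed
  then show ?thesis
    by (intro Lim_null_comparison[OF always_eventually lim] allI)
qed

text \<open>
  At each time the boundary terms disappear at infinity, without any uniformity in time; their
  uniform bound lets dominated convergence do the rest.
\<close>

lemma boundary_work_vanishes:
  assumes M: "\<And>a b. a \<le> b \<Longrightarrow> energy_on e (\<gamma> 0) a b \<le> M"
  shows "(\<lambda>n. integral {0..\<tau>} (\<lambda>s. boundary s (real n) - boundary s (- real n))) \<longlonglongrightarrow> 0"
proof -
  obtain M' where M': "\<And>t a b. t \<in> {0..\<tau>} \<Longrightarrow> a \<le> b \<Longrightarrow> energy_on e (\<gamma> t) a b \<le> M'"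
    using energy_stays_bounded[OF M] by blast
  obtain B where B: "B > 0" "\<And>t x. t \<in> {0..\<tau>} \<Longrightarrow> norm (boundary t x) \<le> B"
    using bounded_cont_bound[OF tame_bounded_cont[OF tame_boundary]] by blast
  have inf: "filterlim (\<lambda>n. real n) at_infinity sequentially" "filterlim (\<lambda>n. - real n) at_infinity sequentially"
    by (simp_all add: filterlim_real_sequentially filterlim_at_top_imp_at_infinity filterlim_uminus_at_bot filterlim_at_bot_imp_at_infinity)
  have "(\<lambda>n. integral {0..\<tau>} (\<lambda>s. boundary s (real n) - boundary s (- real n))) \<longlonglongrightarrow> integral {0..\<tau>} (\<lambda>s. 0)"
  proof (rule dominated_convergence(2)[where h = "\<lambda>s. 2 * B"])
    show "(\<lambda>s. boundary s (real n) - boundary s (- real n)) integrable_on {0..\<tau>}" for n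
      by (intro integrable_continuous_real continuous_intros
          continuous_slice(2)[OF continuous_tame[OF tame_boundary]])
    show "norm (boundary s (real n) - boundary s (- real n)) \<le> 2 * B" if "s \<in> {0..\<tau>}" for n s
      using B(2)[OF that, of "real n"] B(2)[OF that, of "- real n"]
        norm_triangle_ineq4[of "boundary s (real n)" "boundary s (- real n)"] by linarith
    show "(\<lambda>n. boundary s (real n) - boundary s (- real n)) \<longlonglongrightarrow> 0" if "s \<in> {0..\<tau>}" for s
    proof -
      have "(boundary s \<longlongrightarrow> 0) at_infinity" by (rule boundary_vanishes[OF that M'[OF that]])
      from tendsto_diff[OF filterlim_compose[OF this inf(1)] filterlim_compose[OF this inf(2)]]
      show ?thesis by simp
    qed
  qed auto
  then show ?thesis by simp
qed

text \<open>
  If the energy has not dropped at time \<open>\<tau>\<close>, then the balance over \<open>[-n, n]\<close> leaves for the total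
  dissipation only the boundary work, which tends to zero. Comparing suprema over intervals
  avoids speaking of the energy at time \<open>\<tau>\<close> as a limit.
\<close>

lemma no_dissipation:
  assumes M: "\<And>a b. a \<le> b \<Longrightarrow> energy_on e (\<gamma> 0) a b \<le> M"
    and recover: "\<And>a b. a \<le> b \<Longrightarrow> \<exists>c d. c \<le> d \<and> energy_on e (\<gamma> 0) a b \<le> energy_on e (\<gamma> \<tau>) c d"
  shows "w 0 x = 0"
proof -
  have I: "0 \<in> {0..\<tau>}" "\<tau> \<in> {0..\<tau>}" using tau_pos by auto
  define S where "S = {energy_on e (\<gamma> 0) a b | a b. a \<le> b}"
  have bdd: "bdd_above S" unfolding S_def bdd_above_def using M by auto
  have ne: "S \<noteq> {}" unfolding S_def by blast
  have le_Sup: "energy_on e (\<gamma> 0) a b \<le> Sup S" if "a \<le> b" for a b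
    using cSup_upper[OF _ bdd] that unfolding S_def by blast
  \<comment> \<open>a window of positive length around \<open>x\<close> in which the dissipation is measured\<close>
  define r where "r = \<bar>x\<bar> + 1"
  let ?P = "\<lambda>s. integral {-r..r} (dissipation s)"
  let ?W = "\<lambda>n. integral {0..\<tau>} (\<lambda>s. boundary s (real n) - boundary s (- real n))"
  have "integral {0..\<tau>} ?P \<le> 0 + \<epsilon>" if "\<epsilon> > 0" for \<epsilon>
  proof -
    obtain y where "y \<in> S" "Sup S - \<epsilon> < y"
      using less_cSup_iff[OF ne bdd, of "Sup S - \<epsilon>"] \<open>\<epsilon> > 0\<close> by auto
    then obtain a b where ab: "a \<le> b" "Sup S - \<epsilon> < energy_on e (\<gamma> 0) a b" unfolding S_def by auto
    then obtain c d where cd: "c \<le> d" "Sup S - \<epsilon> < energy_on e (\<gamma> \<tau>) c d"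
      using recover[OF ab(1)] by fastforce
    have bound: "integral {0..\<tau>} ?P \<le> ?W n + \<epsilon>" if n: "real n \<ge> max r (max \<bar>c\<bar> \<bar>d\<bar>)" for n
    proof -
      have n': "- real n \<le> real n" "- real n \<le> - r" "r \<le> real n" "- real n \<le> c" "d \<le> real n" using n by linarith+
      have "Sup S - \<epsilon> < energy_on e (\<gamma> \<tau>) (- real n) (real n)"
        using cd energy_on_mono[OF I(2) n'(4,5)] by linarith
      moreover have "integral {0..\<tau>} ?P \<le> integral {0..\<tau>} (\<lambda>s. integral {- real n..real n} (dissipation s))"
        using n' by (intro integral_le integrable_continuous_real continuous_dissipation_integral
            dissipation_integral_mono) auto
      ultimately show ?thesis
        using energy_balance[OF I(2) n'(1)] le_Sup[OF n'(1)] by linarith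
    qed
    have ev: "eventually (\<lambda>n. integral {0..\<tau>} ?P \<le> ?W n + \<epsilon>) sequentially"
    proof -
      obtain N :: nat where N: "max r (max \<bar>c\<bar> \<bar>d\<bar>) \<le> real N" using real_arch_simple by blast
      have "integral {0..\<tau>} ?P \<le> ?W n + \<epsilon>" if "n \<ge> N" for n
        by (rule bound[OF order_trans[OF N]]) (use that in simp)
      then show ?thesis unfolding eventually_sequentially by blast
    qed
    show ?thesis
      by (rule tendsto_lowerbound[OF tendsto_add[OF boundary_work_vanishes[OF M] tendsto_const] ev sequentially_bot])
  qed
  then have "integral {0..\<tau>} ?P \<le> 0" by (rule field_le_epsilon)
  moreover have "0 \<le> integral {0..\<tau>} ?P"
    by (intro Henstock_Kurzweil_Integration.integral_nonneg dissipation_integral_nonneg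
        integrable_continuous_real continuous_dissipation_integral) auto
  ultimately have "?P 0 = 0"
    using integral_eq_0_iff[OF continuous_dissipation_integral tau_pos dissipation_integral_nonneg] I by force
  then have "\<forall>y\<in>{-r..r}. dissipation 0 y = 0"
    using integral_eq_0_iff[OF continuous_slice(1)[OF continuous_dissipation I(1)], of "-r" r] dissipation_nonneg
    by (simp add: r_def)
  moreover have "x \<in> {-r..r}" by (auto simp: r_def)
  ultimately have "dissipation 0 x = 0" by blast
  then show ?thesis using dx_nonzero[OF I(1), of x] by (simp add: dissipation_def)
qed

end

section \<open>Direction energy under isometries and dilations\<close>

lemma derivative_nonneg_of_mono:
  fixes f :: "real \<Rightarrow> real"
  assumes "mono f" "(f has_real_derivative D) (at x)"
  shows "0 \<le> D"
  using mono_on_imp_deriv_nonneg[of UNIV f D x] assms by simp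

text \<open>
  The linear part of the isometry is orthogonal and can be moved onto \<open>e\<close>; a reparametrization
  preserves the energy if it preserves orientation, and replaces \<open>e\<close> by \<open>- e\<close> otherwise.
\<close>

lemma energy_on_isometric:
  fixes c d :: "real \<Rightarrow> 'a::euclidean_space"
  assumes iso: "isometric_curves c (\<lambda>x. \<alpha> *\<^sub>R d x)" and \<alpha>: "\<alpha> > 0"
    and d: "\<And>x. d differentiable (at x)" and cont: "continuous_on UNIV (dx d)"
    and e: "norm e = 1"
  obtains e' where "norm e' = 1"
    and "\<And>p q. p \<le> q \<Longrightarrow> \<exists>a b. a \<le> b \<and> energy_on e c a b = \<alpha> * energy_on e' d p q"
proof -
  obtain \<Phi> \<phi> where \<Phi>: "\<And>p q. dist (\<Phi> p) (\<Phi> q) = dist p q" and \<phi>: "reparametrization \<phi>"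
    and c: "c = \<Phi> \<circ> (\<lambda>x. \<alpha> *\<^sub>R d x) \<circ> \<phi>"
    using iso unfolding isometric_curves_def by blast
  define L where "L x = \<Phi> x - \<Phi> 0" for x
  have L: "orthogonal_transformation L"
    unfolding orthogonal_transformation_isometry using \<Phi> by (simp add: L_def dist_norm)
  then have lin: "bounded_linear L"
    using orthogonal_transformation_linear linear_conv_bounded_linear by blast
  obtain e0 where e0: "L e0 = e" using orthogonal_transformation_surj[OF L] by (metis surjD)
  have norm_e0: "norm e0 = 1" using e e0 orthogonal_transformation_norm[OF L] by metis
  have d\<phi>: "(\<phi> has_real_derivative dx \<phi> x) (at x)" for x
    using \<phi> unfolding reparametrization_def smooth_def
    by (metis funpow_0 has_real_derivative_iff_has_vector_derivative vector_derivative_works)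
  have cont\<phi>: "continuous_on A \<phi>" for A
    using d\<phi> by (meson DERIV_continuous_on has_field_derivative_at_within)
  have bij: "bij \<phi>" using \<phi> by (simp add: reparametrization_def)
  have dc: "dx c x = (\<alpha> * dx \<phi> x) *\<^sub>R L (dx d (\<phi> x))" for x
  proof -
    have c': "c = (\<lambda>x. \<Phi> 0 + L (\<alpha> *\<^sub>R (d \<circ> \<phi>) x))" by (auto simp: c L_def)
    have "((d \<circ> \<phi>) has_vector_derivative dx \<phi> x *\<^sub>R dx d (\<phi> x)) (at x)"
      using vector_diff_chain_at[of \<phi> "dx \<phi> x" x d] d\<phi>[of x] d[of "\<phi> x"]
      by (simp add: has_real_derivative_iff_has_vector_derivative vector_derivative_works)
    then have "((\<lambda>x. \<alpha> *\<^sub>R (d \<circ> \<phi>) x) has_vector_derivative \<alpha> *\<^sub>R (dx \<phi> x *\<^sub>R dx d (\<phi> x))) (at x)"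
      by (rule bounded_linear.has_vector_derivative[OF bounded_linear_scaleR_right])
    from has_vector_derivative_add[OF has_vector_derivative_const bounded_linear.has_vector_derivative[OF lin this]]
    show ?thesis
      unfolding c' using linear_cmul[OF orthogonal_transformation_linear[OF L]]
      by (intro vector_derivative_at) simp
  qed
  have norm_dc: "norm (dx c x) = \<alpha> * (\<bar>dx \<phi> x\<bar> * norm (dx d (\<phi> x)))" for x
    unfolding dc using \<alpha> orthogonal_transformation_norm[OF L] by (simp add: abs_mult)
  have dc_e: "dx c x \<bullet> e = \<alpha> * (dx \<phi> x * (dx d (\<phi> x) \<bullet> e0))" for x
    unfolding dc e0[symmetric] using L by (simp add: orthogonal_transformation_def)
  have cont_h: "continuous_on A (\<lambda>y. \<alpha> * (norm (dx d y) - dx d y \<bullet> e'))" for A e'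
    by (intro continuous_intros continuous_on_subset[OF cont]) auto
  consider "strict_mono \<phi>" | "strict_antimono_on UNIV \<phi>"
    using injective_eq_monotone_map[of UNIV \<phi>] cont\<phi> bij_is_inj[OF bij] by auto
  then show ?thesis
  proof cases
    case 1
    have pos: "dx \<phi> x \<ge> 0" for x
      by (rule derivative_nonneg_of_mono[OF strict_mono_mono[OF 1] d\<phi>])
    show ?thesis
    proof (rule that[OF norm_e0])
      fix p q :: real assume "p \<le> q"
      obtain a b where ab: "\<phi> a = p" "\<phi> b = q" using bij by (metis bij_pointE)
      with \<open>p \<le> q\<close> have "a \<le> b" using strict_mono_less_eq[OF 1] by metis
      let ?h = "\<lambda>y. \<alpha> * (norm (dx d y) - dx d y \<bullet> e0)"
      have "((\<lambda>x. dx \<phi> x *\<^sub>R ?h (\<phi> x)) has_integral (integral {\<phi> a..\<phi> b} ?h)) {a..b}"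
      proof (rule has_integral_substitution[OF \<open>a \<le> b\<close> _ _ cont_h has_field_derivative_at_within[OF d\<phi>]])
        show "\<phi> a \<le> \<phi> b" using ab \<open>p \<le> q\<close> by simp
        show "\<phi> ` {a..b} \<subseteq> {\<phi> a..\<phi> b}" by (auto simp: strict_mono_less_eq[OF 1])
      qed
      moreover have "dx \<phi> x *\<^sub>R ?h (\<phi> x) = norm (dx c x) - dx c x \<bullet> e" for x
        using pos[of x] by (simp add: norm_dc dc_e algebra_simps)
      ultimately have "energy_on e c a b = integral {p..q} ?h"
        by (simp add: energy_on_def integral_unique ab)
      with \<open>a \<le> b\<close> show "\<exists>a b. a \<le> b \<and> energy_on e c a b = \<alpha> * energy_on e0 d p q"
        by (auto simp: energy_on_def)
    qed
  next
    case 2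
    have anti: "\<phi> x \<le> \<phi> y \<longleftrightarrow> y \<le> x" for x y
      using 2 unfolding monotone_on_def by (metis UNIV_I linorder_not_le nle_le order_less_imp_le)
    have "mono (\<lambda>x. - \<phi> x)" by (auto intro!: monoI simp: anti)
    then have "0 \<le> - dx \<phi> x" for x
      by (rule derivative_nonneg_of_mono) (rule DERIV_minus[OF d\<phi>])
    then have neg: "dx \<phi> x \<le> 0" for x by (simp only: neg_0_le_iff_le)
    show ?thesis
    proof (rule that[of "- e0"])
      show "norm (- e0) = 1" using norm_e0 by simp
      fix p q :: real assume "p \<le> q"
      obtain a b where ab: "\<phi> a = q" "\<phi> b = p" using bij by (metis bij_pointE)
      with \<open>p \<le> q\<close> have "a \<le> b" using anti by metis
      let ?h = "\<lambda>y. \<alpha> * (norm (dx d y) - dx d y \<bullet> (- e0))"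
      have subst: "((\<lambda>x. dx \<phi> x *\<^sub>R ?h (\<phi> x)) has_integral
          (integral {\<phi> a..\<phi> b} ?h - integral {\<phi> b..\<phi> a} ?h)) {a..b}"
        using \<open>a \<le> b\<close> \<open>p \<le> q\<close>
        by (intro has_integral_substitution_general[where s = "{}" and c = p and d = q] cont_h cont\<phi>)
          (auto simp: anti simp flip: ab intro: has_field_derivative_at_within[OF d\<phi>])
      \<comment> \<open>here \<open>\<phi> b \<le> \<phi> a\<close>, so this integral is over at most one point\<close>
      have "integral {\<phi> a..\<phi> b} ?h = 0"
        using \<open>p \<le> q\<close> by (cases "p = q") (auto simp: ab)
      then have "integral {\<phi> a..\<phi> b} ?h - integral {\<phi> b..\<phi> a} ?h = - integral {p..q} ?h"
        unfolding ab by linarith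
      with subst have "((\<lambda>x. dx \<phi> x *\<^sub>R ?h (\<phi> x)) has_integral - integral {p..q} ?h) {a..b}"
        by (simp only:)
      from has_integral_neg[OF this]
      have "((\<lambda>x. - (dx \<phi> x *\<^sub>R ?h (\<phi> x))) has_integral integral {p..q} ?h) {a..b}"
        by (simp only: minus_minus)
      moreover have "- (dx \<phi> x *\<^sub>R ?h (\<phi> x)) = norm (dx c x) - dx c x \<bullet> e" for x
        using neg[of x] by (simp add: norm_dc dc_e algebra_simps)
      ultimately have "energy_on e c a b = integral {p..q} ?h"
        by (simp add: energy_on_def integral_unique)
      with \<open>a \<le> b\<close> show "\<exists>a b. a \<le> b \<and> energy_on e c a b = \<alpha> * energy_on (- e0) d p q"
        by (auto simp: energy_on_def)
    qed
  qed
qed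

text \<open>
  Two directional energies of finite size are incompatible on a curve of infinite length: the sum
  of the densities for \<open>e\<close> and \<open>e'\<close> is at least \<open>2 - \<bar>e + e'\<bar> > 0\<close> times the speed.
\<close>

lemma energy_on_other_direction:
  fixes d :: "real \<Rightarrow> 'a::euclidean_space"
  assumes cont: "continuous_on UNIV (dx d)" and m: "m > 0" "\<And>x. m \<le> norm (dx d x)"
    and e: "norm e = 1" "norm e' = 1" "e' \<noteq> e"
    and M: "\<And>a b. a \<le> b \<Longrightarrow> energy_on e d a b \<le> M"
  obtains r where "r \<ge> 0" "K \<le> energy_on e' d 0 r"
proof -
  define k where "k = 2 - norm (e + e')"
  have "(norm (e + e'))\<^sup>2 = 4 - (norm (e - e'))\<^sup>2"
    using e(1,2) dot_norm[of e e'] dot_norm_neg[of e e'] by simp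
  also have "\<dots> < 2\<^sup>2" using e(3) by simp
  finally have k: "k > 0" unfolding k_def using power_less_imp_less_base[of "norm (e + e')" 2 2] by simp
  have pointwise: "m * k - (norm v - v \<bullet> e) \<le> norm v - v \<bullet> e'" if "m \<le> norm v" for v
  proof -
    have "m * k \<le> norm v * k" using that k by (intro mult_right_mono) auto
    moreover have "v \<bullet> (e + e') \<le> norm v * norm (e + e')" by (rule norm_cauchy_schwarz)
    ultimately show ?thesis by (simp add: k_def inner_add_right algebra_simps)
  qed
  have int: "(\<lambda>x. norm (dx d x) - dx d x \<bullet> u) integrable_on {a..b}" for u a b
    by (intro integrable_continuous_real continuous_intros continuous_on_subset[OF cont]) auto
  have lower: "m * k * r - M \<le> energy_on e' d 0 r" if "r \<ge> 0" for r
  proof -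
    have "integral {0..r} (\<lambda>x. m * k - (norm (dx d x) - dx d x \<bullet> e)) \<le> energy_on e' d 0 r"
      unfolding energy_on_def
      by (intro integral_le int integrable_diff pointwise m) auto
    moreover have "integral {0..r} (\<lambda>x. m * k - (norm (dx d x) - dx d x \<bullet> e)) = m * k * r - energy_on e d 0 r"
      unfolding energy_on_def using that by (subst integral_diff) (auto intro: int)
    ultimately show ?thesis using M[OF that] by linarith
  qed
  \<comment> \<open>the length at which the lower bound has surely reached \<open>K\<close>\<close>
  define r where "r = \<bar>K + M\<bar> / (m * k)"
  have "r \<ge> 0" "m * k * r = \<bar>K + M\<bar>" using m k by (auto simp: r_def)
  with lower[of r] that show ?thesis by (smt (verit))
qed

text \<open>
  An isometric image of an enlargement of \<open>d\<close> has energy \<open>\<alpha>\<close> times that of \<open>d\<close> in some direction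
  \<open>e'\<close>. Either \<open>e' = e\<close>, and \<open>\<alpha> \<ge> 1\<close> finishes, or the energy in direction \<open>e'\<close> is infinite.
\<close>

lemma isometric_recovers_energy:
  fixes c d :: "real \<Rightarrow> 'a::euclidean_space"
  assumes iso: "isometric_curves c (\<lambda>x. \<alpha> *\<^sub>R d x)" and \<alpha>: "\<alpha> \<ge> 1"
    and d: "\<And>x. d differentiable (at x)" and cont: "continuous_on UNIV (dx d)"
    and m: "m > 0" "\<And>x. m \<le> norm (dx d x)"
    and e: "norm e = 1" and M: "\<And>a b. a \<le> b \<Longrightarrow> energy_on e d a b \<le> M"
    and "p \<le> q"
  shows "\<exists>a b. a \<le> b \<and> energy_on e d p q \<le> energy_on e c a b"
proof -
  obtain e' where e': "norm e' = 1"
    "\<And>p q. p \<le> q \<Longrightarrow> \<exists>a b. a \<le> b \<and> energy_on e c a b = \<alpha> * energy_on e' d p q"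
    using energy_on_isometric[OF iso _ d cont e] \<alpha> by (metis less_le_trans zero_less_one)
  have nonneg: "0 \<le> energy_on e' d a b" for a b
    unfolding energy_on_def
    by (intro Henstock_Kurzweil_Integration.integral_nonneg integrable_continuous_real
        continuous_intros continuous_on_subset[OF cont] energy_density_nonneg[OF e'(1)]) auto
  obtain p' q' where pq': "p' \<le> q'" "energy_on e d p q \<le> energy_on e' d p' q'"
  proof (cases "e' = e")
    case True
    then show ?thesis using that \<open>p \<le> q\<close> by blast
  next
    case False
    then show ?thesis using energy_on_other_direction[OF cont m e e'(1) _ M] that by metis
  qed
  obtain a b where "a \<le> b" "energy_on e c a b = \<alpha> * energy_on e' d p' q'" using e'(2)[OF pq'(1)] by blast
  moreover have "energy_on e' d p' q' \<le> \<alpha> * energy_on e' d p' q'"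
    using \<alpha> nonneg[of p' q'] mult_right_mono[of 1 \<alpha>] by fastforce
  ultimately show ?thesis using pq'(2) by fastforce
qed

section \<open>Curves without curvature\<close>

text \<open>
  The chain rule costs the inner function one order less than the outer one, which is what allows
  the bootstrap for inverse functions below.
\<close>

lemma tame_upto_compose:
  fixes g :: "real \<Rightarrow> 'a::real_normed_vector"
  assumes "tame {0} (\<lambda>_. g)" and \<psi>: "\<And>x. \<psi> differentiable (at x)"
    and "\<And>j. j < k \<Longrightarrow> tame_upto j {0} (\<lambda>_. dx \<psi>)"
  shows "tame_upto k {0} (\<lambda>_ x. g (\<psi> x))"
proof -
  have bc: "bounded_cont {0} (\<lambda>_ x. g (\<psi> x))" if g: "tame {0} (\<lambda>_. g)" for g :: "real \<Rightarrow> 'a"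
  proof -
    obtain B where B: "B > 0" "\<And>x. norm (g x) \<le> B"
      using bounded_cont_bound[OF tame_bounded_cont[OF g]] by (metis singletonI)
    have cont_g: "isCont g x" for x
      using has_vector_derivative_continuous[OF tame_has_dx[OF g, of 0]] by simp
    have cont_\<psi>: "isCont \<psi> x" for x
      using \<psi>[of x] by (rule differentiable_imp_continuous_within)
    have "continuous_on UNIV (\<lambda>x. g (\<psi> x))"
      by (rule continuous_at_imp_continuous_on) (blast intro: isCont_o2[OF cont_\<psi> cont_g])
    then have "continuous_on ({0} \<times> UNIV) (\<lambda>z::real \<times> real. g (\<psi> (snd z)))"
      by (rule continuous_on_compose2) (auto intro!: continuous_intros)
    then show ?thesis
      using B by (intro bounded_contI[where B = B]) (auto simp: case_prod_unfold)
  qed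
  show ?thesis using assms(1,3)
  proof (induction k arbitrary: g)
    case 0
    then show ?case using bc by simp
  next
    case (Suc k)
    have D: "((\<lambda>x. g (\<psi> x)) has_vector_derivative dx \<psi> x *\<^sub>R dx g (\<psi> x)) (at x)" for x
      using vector_diff_chain_at[of \<psi> "dx \<psi> x" x g "dx g (\<psi> x)"] \<psi>[of x]
        tame_has_dx[OF Suc.prems(1), of 0 "\<psi> x"]
      by (simp add: vector_derivative_works[symmetric] o_def)
    have "tame_upto k {0} (\<lambda>_ x. dx g (\<psi> x))"
      by (rule Suc.IH[OF tame_dx[OF Suc.prems(1)]]) (simp add: Suc.prems(2))
    then have "tame_upto k {0} (\<lambda>_ x. dx \<psi> x *\<^sub>R dx g (\<psi> x))"
      using Suc.prems(2)[of k] by (intro tame_upto_bilinear[OF bounded_bilinear_scaleR]) auto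
    also have "?this \<longleftrightarrow> tame_upto k {0} (\<lambda>t. dx (\<lambda>x. g (\<psi> x)))"
      by (intro tame_upto_cong vector_derivative_at[symmetric] D)
    finally show ?case using bc[OF Suc.prems(1)] D by (auto intro: differentiableI_vector)
  qed
qed

lemma zero_vector_derivative_imp_eq:
  fixes f :: "real \<Rightarrow> 'a::real_normed_vector"
  assumes "\<And>x. (f has_vector_derivative 0) (at x)"
  shows "f x = f y"
  using has_vector_derivative_zero_constant[of UNIV f] assms by (metis UNIV_I convex_UNIV)

lemma tame_slice:
  assumes "tame I f" "t \<in> I"
  shows "tame {0} (\<lambda>_. f t)"
proof -
  have bc: "bounded_cont {0} (\<lambda>_. g t)" if g: "bounded_cont I g" for g :: "real \<Rightarrow> real \<Rightarrow> 'a"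
  proof -
    obtain B where B: "B > 0" "\<And>x. norm (g t x) \<le> B"
      using bounded_cont_bound[OF g] \<open>t \<in> I\<close> by metis
    have c: "continuous_on (I \<times> UNIV) (\<lambda>(t, x). g t x)"
      using g by (simp add: bounded_cont_def)
    have "continuous_on ({0} \<times> UNIV) (\<lambda>z. (\<lambda>(t, x). g t x) (t, snd z))"
      by (rule continuous_on_compose2[OF c]) (use \<open>t \<in> I\<close> in \<open>auto intro!: continuous_intros\<close>)
    then show ?thesis using B(2) by (intro bounded_contI[where B = B]) (auto simp: case_prod_unfold)
  qed
  have "tame_upto k {0} (\<lambda>_. f t)" for k
    using assms(1)
  proof (induction k arbitrary: f)
    case 0
    then show ?case using bc[OF tame_bounded_cont] by simp
  next
    case (Suc k)
    have "tame_upto k {0} (\<lambda>_. dx (f t))" using Suc.IH[OF tame_dx[OF Suc.prems]] .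
    then show ?case
      using bc[OF tame_bounded_cont[OF Suc.prems]] tame_has_dx[OF Suc.prems \<open>t \<in> I\<close>]
      by (auto intro: differentiableI_vector)
  qed
  then show ?thesis by (simp add: tame_def)
qed

lemma smooth_of_tame:
  assumes "\<And>x. f differentiable (at x)" "tame {0} (\<lambda>_. dx f)"
  shows "smooth f"
  unfolding smooth_def
proof (intro allI)
  fix k x
  show "(dx ^^ k) f differentiable (at x)"
  proof (cases k)
    case 0
    then show ?thesis using assms(1) by simp
  next
    case (Suc j)
    then show ?thesis
      using tame_has_dx[OF tame_funpow[OF assms(2), of j], of 0 x]
      by (simp add: funpow_Suc_right differentiableI_vector del: funpow.simps)
  qed
qed

text \<open>
  The inverse \<open>\<psi>\<close> solves \<open>\<psi>' = (1 / \<phi>') \<circ> \<psi>\<close>, so bounds of order \<open>k\<close> on \<open>\<psi>'\<close> follow from those of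
  smaller order. The lower bound on \<open>\<phi>'\<close> gives surjectivity as well.
\<close>

lemma reparametrization_of_tame:
  fixes \<phi> :: "real \<Rightarrow> real"
  assumes \<phi>: "\<And>x. \<phi> differentiable (at x)" and tame: "tame {0} (\<lambda>_. dx \<phi>)"
    and m: "m > 0" "\<And>x. m \<le> dx \<phi> x"
  shows "reparametrization \<phi>"
proof -
  have D: "(\<phi> has_real_derivative dx \<phi> x) (at x)" for x
    using \<phi> by (simp add: has_real_derivative_iff_has_vector_derivative vector_derivative_works)
  have pos: "dx \<phi> x > 0" for x using m(2)[of x] m(1) by linarith
  have "strict_mono \<phi>"
    by (rule strict_monoI, erule DERIV_pos_imp_increasing) (use D pos in blast)
  then have inj: "inj \<phi>" by (rule strict_mono_imp_inj_on)
  have cont: "isCont \<phi> x" for x using D by (rule DERIV_isCont)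
  have surj: "\<exists>x. \<phi> x = y" for y
  proof -
    define r where "r = \<bar>y - \<phi> 0\<bar> / m"
    have r: "r \<ge> 0" "m * r = \<bar>y - \<phi> 0\<bar>" using m by (auto simp: r_def)
    have "\<phi> a - m * a \<le> \<phi> b - m * b" if "a \<le> b" for a b
      by (rule DERIV_nonneg_imp_nondecreasing[OF that])
        (use D m(2) in \<open>auto intro!: exI derivative_eq_intros\<close>)
    from this[of "-r" 0] this[of 0 r] r have "\<phi> (- r) \<le> y" "y \<le> \<phi> r" by auto
    then show ?thesis using IVT[of \<phi> "-r" y r] cont r(1) by auto
  qed
  then have bij: "bij \<phi>" using inj by (metis bijI surjI)
  define \<psi> where "\<psi> = inv \<phi>"
  have \<phi>\<psi>: "\<phi> (\<psi> y) = y" for y using bij by (simp add: \<psi>_def bij_is_surj surj_f_inv_f)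
  have \<psi>\<phi>: "\<psi> (\<phi> x) = x" for x using inj by (simp add: \<psi>_def)
  have cont\<psi>: "isCont \<psi> y" for y
    using isCont_inverse_function[of 1 "\<psi> y" \<psi> \<phi>] cont \<psi>\<phi> \<phi>\<psi> by simp
  have D\<psi>: "(\<psi> has_vector_derivative 1 / norm (dx \<phi> (\<psi> y))) (at y)" for y
  proof -
    have "(\<psi> has_real_derivative inverse (dx \<phi> (\<psi> y))) (at y)"
      by (rule DERIV_inverse_function[of \<phi> _ \<psi> y "y - 1" "y + 1"])
        (use D \<phi>\<psi> cont\<psi> pos[of "\<psi> y"] in auto)
    then show ?thesis
      using pos[of "\<psi> y"] by (simp add: has_real_derivative_iff_has_vector_derivative inverse_eq_divide)
  qed
  have \<psi>: "\<psi> differentiable (at y)" for y using D\<psi> by (rule differentiableI_vector)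
  have h: "tame {0} (\<lambda>_ x. 1 / norm (dx \<phi> x))"
    by (rule tame_inverse_norm[OF tame m(1)]) (use m(2) abs_ge_self order_trans in \<open>fastforce\<close>)
  have "tame_upto k {0} (\<lambda>_. dx \<psi>)" for k
  proof (induction k rule: less_induct)
    case (less k)
    have "tame_upto k {0} (\<lambda>_ y. 1 / norm (dx \<phi> (\<psi> y)))"
      by (rule tame_upto_compose[OF h \<psi> less])
    then show ?case
      using vector_derivative_at[OF D\<psi>] by simp
  qed
  then have "smooth \<psi>" by (intro smooth_of_tame \<psi>) (simp add: tame_def)
  moreover have "smooth \<phi>" by (intro smooth_of_tame \<phi> tame)
  ultimately show ?thesis using bij by (simp add: reparametrization_def \<psi>_def)
qed

text \<open>
  The tangent is a constant \<open>v\<close>, and the displacement along \<open>v\<close> is the arclength parameter, whose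
  derivative is the speed.
\<close>

lemma (in curve_family) straight_line_of_curvature_0:
  assumes t: "t \<in> I" and \<kappa>: "\<And>x. curvature (\<gamma> t) x = 0"
  shows "straight_line (\<gamma> t)"
proof -
  let ?c = "\<gamma> t"
  define v where "v = unit_tangent ?c 0"
  have "(unit_tangent ?c has_vector_derivative 0) (at x)" for x
    using unit_tangent_has_derivative[OF t, of x] \<kappa> by simp
  then have T: "unit_tangent ?c x = v" for x
    unfolding v_def by (rule zero_vector_derivative_imp_eq)
  have v: "norm v = 1" unfolding v_def by (rule norm_unit_tangent[OF t])
  \<comment> \<open>the arclength parameter of a straight curve, written without an integral\<close>
  define \<phi> where "\<phi> x = (?c x - ?c 0) \<bullet> v" for x
  have dc: "(?c has_vector_derivative dx ?c x) (at x)" for x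
    using differentiable[OF t] by (simp add: vector_derivative_works)
  have D: "(\<phi> has_vector_derivative norm (dx ?c x)) (at x)" for x
  proof -
    have "((\<lambda>x. ?c x - ?c 0) has_vector_derivative dx ?c x - 0) (at x)"
      by (intro has_vector_derivative_diff dc has_vector_derivative_const)
    from bounded_linear.has_vector_derivative[OF bounded_linear_inner_left this]
    have "(\<phi> has_vector_derivative dx ?c x \<bullet> v) (at x)" by (simp add: \<phi>_def[abs_def])
    moreover have "dx ?c x \<bullet> v = norm (dx ?c x)"
      using dx_eq_speed_tangent[OF t, of x] v T[of x] by (metis inner_scaleR_left norm_eq_1 mult.right_neutral)
    ultimately show ?thesis by simp
  qed
  have d\<phi>: "dx \<phi> x = norm (dx ?c x)" for x by (rule vector_derivative_at[OF D])
  have "reparametrization \<phi>"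
  proof (rule reparametrization_of_tame[OF _ _ m_pos])
    show "\<phi> differentiable (at x)" for x using D by (rule differentiableI_vector)
    show "m \<le> dx \<phi> x" for x unfolding d\<phi> by (rule speed_ge[OF t])
    have "tame I (\<lambda>t x. dx (\<gamma> t) x \<bullet> unit_tangent (\<gamma> t) x)"
      by (intro tame_inner tame_velocity tame_unit_tangent)
    moreover have "dx (\<gamma> t) x \<bullet> unit_tangent (\<gamma> t) x = dx \<phi> x" for x
      using energy_density_eq[OF t, of x 0] by (simp add: d\<phi>)
    ultimately show "tame {0} (\<lambda>_. dx \<phi>)" using tame_slice[OF _ t] by fastforce
  qed
  moreover have "?c x = ?c 0 + \<phi> x *\<^sub>R v" for x
  proof -
    have "((\<lambda>x. ?c x - \<phi> x *\<^sub>R v) has_vector_derivative 0) (at x)" for x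
    proof -
      have "((\<lambda>x. ?c x - \<phi> x *\<^sub>R v) has_vector_derivative dx ?c x - norm (dx ?c x) *\<^sub>R v) (at x)"
        by (intro has_vector_derivative_diff dc bounded_linear.has_vector_derivative[OF bounded_linear_scaleR_left] D)
      then show ?thesis using dx_eq_speed_tangent[OF t, of x] T[of x] by simp
    qed
    then have "?c x - \<phi> x *\<^sub>R v = ?c 0 - \<phi> 0 *\<^sub>R v" by (rule zero_vector_derivative_imp_eq)
    then show ?thesis by (simp add: \<phi>_def algebra_simps)
  qed
  ultimately show ?thesis unfolding straight_line_def using v by (metis norm_zero zero_neq_one)
qed

section \<open>Solitons of finite direction energy\<close>

lemma partial_x_funpow: "(partial_x ^^ k) u t = (dx ^^ k) (u t)"
proof (induction k)
  case (Suc k)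
  then show ?case by (simp add: partial_x_def[abs_def])
qed simp

lemma funpow_dx_add:
  assumes "\<And>k x. (dx ^^ k) f differentiable (at x)" "\<And>k x. (dx ^^ k) g differentiable (at x)"
  shows "(dx ^^ k) (\<lambda>x. f x + g x) = (\<lambda>x. (dx ^^ k) f x + (dx ^^ k) g x)"
proof (induction k)
  case (Suc k)
  then show ?case using assms by (simp add: vector_derivative_add_at)
qed simp

text \<open>
  The flow is controlled relative to its initial curve: uniform bounds on the derivatives of
  \<open>\<gamma> - \<gamma>0\<close> and of \<open>\<gamma>0\<close> add up to bounds on those of \<open>\<gamma>\<close>.
\<close>

lemma flow_solution_evolution:
  fixes \<gamma>0 :: "real \<Rightarrow> 'a::euclidean_space"
  assumes sol: "flow_solution V \<gamma>0 \<tau> \<gamma>" and \<gamma>0: "dot_smooth \<gamma>0" and \<tau>: "\<tau> > 0"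
  obtains m where "evolution \<tau> \<gamma> m (\<lambda>t. V (\<gamma> t)) (partial \<tau> 1 1 \<gamma>)"
proof -
  let ?I = "{0..\<tau>}"
  define u where "u t x = \<gamma> t x - \<gamma>0 x" for t x
  have strip: "smooth_strip \<tau> \<gamma>" and ustrip: "smooth_strip \<tau> u"
    and ubound: "\<And>k. bounded ((\<lambda>(t, x). partial \<tau> 0 k u t x) ` (?I \<times> UNIV))"
    and flow: "\<And>t x. t \<in> ?I \<Longrightarrow> partial_t \<tau> \<gamma> t x = V (\<gamma> t) x"
    using sol unfolding flow_solution_def bounded_smooth_strip_def u_def by auto
  have p0: "partial \<tau> 0 k f t = (dx ^^ k) (f t)" for k t and f :: "real \<Rightarrow> real \<Rightarrow> 'a"
    by (simp add: partial_def partial_x_funpow)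
  have x_diff: "(dx ^^ k) (f t) differentiable (at x)"
    if "smooth_strip \<tau> f" "t \<in> ?I" for f :: "real \<Rightarrow> real \<Rightarrow> 'a" and k t x
    using that unfolding smooth_strip_def p0[symmetric] by blast
  have t_diff: "((\<lambda>s. (dx ^^ k) (\<gamma> s) x) has_vector_derivative partial \<tau> 1 k \<gamma> t x) (at t within ?I)"
    if "t \<in> ?I" for k t x
  proof -
    have "(\<lambda>s. partial \<tau> 0 k \<gamma> s x) differentiable (at t within ?I)"
      using strip that unfolding smooth_strip_def by blast
    then show ?thesis
      unfolding p0 by (simp add: vector_derivative_works partial_def partial_t_def[abs_def] partial_x_funpow)
  qed
  obtain m where m: "m > 0" "\<And>t x. t \<in> ?I \<Longrightarrow> m \<le> norm (dx (\<gamma> t) x)"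
  proof
    let ?m = "INF (t, x)\<in>?I \<times> UNIV. norm (partial_x \<gamma> t x)"
    show "?m > 0" using sol unfolding flow_solution_def by blast
    show "?m \<le> norm (dx (\<gamma> t) x)" if "t \<in> ?I" for t x
    proof -
      have "bdd_below ((\<lambda>(t, x). norm (partial_x \<gamma> t x)) ` (?I \<times> UNIV))"
        by (intro bdd_belowI[where m = 0]) auto
      from cINF_lower[OF this, of "(t, x)"] that show ?thesis by (simp add: partial_x_def)
    qed
  qed
  have tame: "tame ?I (\<lambda>t. dx (\<gamma> t))"
    unfolding tame_def
  proof (intro allI tame_upto_funpow)
    fix k
    have shift: "(dx ^^ k) (dx f) = (dx ^^ Suc k) f" for f :: "real \<Rightarrow> 'a"
      by (simp add: funpow_Suc_right del: funpow.simps)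
    show "(dx ^^ k) (dx (\<gamma> t)) differentiable (at x)" if "t \<in> ?I" for t x
      unfolding shift by (rule x_diff[OF strip that])
    show "bounded_cont ?I (\<lambda>t. (dx ^^ k) (dx (\<gamma> t)))"
    proof -
      obtain A where A: "\<And>t x. t \<in> ?I \<Longrightarrow> norm ((dx ^^ Suc k) (u t) x) \<le> A"
        using ubound[of "Suc k"] unfolding bounded_iff p0 by fastforce
      have "bounded (range ((dx ^^ Suc k) \<gamma>0))"
        using \<gamma>0 unfolding dot_smooth_def by (metis One_nat_def Suc_le_mono le0)
      then obtain B where B: "\<And>x. norm ((dx ^^ Suc k) \<gamma>0 x) \<le> B"
        unfolding bounded_iff by auto
      show ?thesis unfolding shift
      proof (rule bounded_contI[where B = "A + B"])
        show "continuous_on (?I \<times> UNIV) (\<lambda>(t, x). (dx ^^ Suc k) (\<gamma> t) x)"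
          using strip unfolding smooth_strip_def p0[symmetric] by blast
        show "norm ((dx ^^ Suc k) (\<gamma> t) x) \<le> A + B" if "t \<in> ?I" for t x
        proof -
          have g0: "(dx ^^ j) \<gamma>0 differentiable (at x)" for j x
            using \<gamma>0 unfolding dot_smooth_def smooth_def by blast
          have "\<gamma> t = (\<lambda>x. u t x + \<gamma>0 x)" by (simp add: u_def)
          then have "(dx ^^ Suc k) (\<gamma> t) = (dx ^^ Suc k) (\<lambda>x. u t x + \<gamma>0 x)" by (rule arg_cong)
          also have "\<dots> = (\<lambda>x. (dx ^^ Suc k) (u t) x + (dx ^^ Suc k) \<gamma>0 x)"
            by (rule funpow_dx_add[OF x_diff[OF ustrip that] g0])
          finally have "(dx ^^ Suc k) (\<gamma> t) x = (dx ^^ Suc k) (u t) x + (dx ^^ Suc k) \<gamma>0 x"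
            by (rule fun_cong)
          also have "norm \<dots> \<le> A + B" by (intro norm_triangle_mono A B that)
          finally show ?thesis .
        qed
      qed
    qed
  qed
  have "evolution \<tau> \<gamma> m (\<lambda>t. V (\<gamma> t)) (partial \<tau> 1 1 \<gamma>)"
  proof
    show "tame ?I (\<lambda>t. dx (\<gamma> t))" by (rule tame)
    show "\<gamma> t differentiable (at x)" if "t \<in> ?I" for t x
      using x_diff[OF strip that, of 0] by simp
    show "((\<lambda>s. \<gamma> s x) has_vector_derivative V (\<gamma> t) x) (at t within ?I)" if "t \<in> ?I" for t x
      using t_diff[OF that, of 0 x] flow[OF that, of x] by (simp add: partial_def)
    show "((\<lambda>s. dx (\<gamma> s) x) has_vector_derivative partial \<tau> 1 1 \<gamma> t x) (at t within ?I)" if "t \<in> ?I" for t x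
      using t_diff[OF that, of 1 x] by simp
    show "continuous_on (?I \<times> UNIV) (\<lambda>(t, x). partial \<tau> 1 1 \<gamma> t x)"
      using strip unfolding smooth_strip_def by blast
  qed (use m \<tau> in auto)
  then show ?thesis using that by blast
qed

text \<open>
  A single later time at which the flow is isometric to an enlargement of the initial curve is
  enough: the energy has not decreased up to that time, so there was no dissipation at time \<open>0\<close>,
  and \<open>\<bar>\<kappa>\<bar>\<close> is constant there; it is zero because it vanishes at infinity.
\<close>

lemma energy_recovering_flow_is_straight:
  fixes \<gamma>0 :: "real \<Rightarrow> 'a::euclidean_space"
  assumes sol: "flow_solution V \<gamma>0 \<tau> \<gamma>" and \<gamma>0: "dot_smooth \<gamma>0" and \<tau>: "\<tau> > 0"
    and V: "V \<in> {curve_shortening, surface_diffusion, chen}"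
    and iso: "isometric_curves (\<gamma> \<tau>) (\<lambda>x. \<alpha> *\<^sub>R \<gamma>0 x)" and \<alpha>: "\<alpha> \<ge> 1"
    and e: "norm e = 1" and fin: "direction_energy e \<gamma>0 < \<infinity>"
  shows "straight_line \<gamma>0"
proof -
  obtain m where "evolution \<tau> \<gamma> m (\<lambda>t. V (\<gamma> t)) (partial \<tau> 1 1 \<gamma>)"
    using flow_solution_evolution[OF sol \<gamma>0 \<tau>] .
  then interpret evolution \<tau> \<gamma> m "\<lambda>t. V (\<gamma> t)" "partial \<tau> 1 1 \<gamma>" .
  have I: "0 \<in> {0..\<tau>}" using \<tau> by simp
  have start: "\<gamma> 0 = \<gamma>0" using sol by (simp add: flow_solution_def)
  have cont: "continuous_on UNIV (dx \<gamma>0)"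
    using continuous_slice(1)[OF continuous_tame[OF tame_velocity] I] by (simp add: start)
  obtain M where M: "\<And>a b. a \<le> b \<Longrightarrow> energy_on e \<gamma>0 a b \<le> M"
    using direction_energy_bound[OF e fin cont] dx_nonzero[OF I] by (auto simp: start)
  obtain Q w where grad: "gradient_velocity (\<lambda>t. V (\<gamma> t)) Q w"
    and rigid: "\<And>t x y. t \<in> {0..\<tau>} \<Longrightarrow> \<forall>x. w t x = 0 \<Longrightarrow>
      norm (curvature (\<gamma> t) x) = norm (curvature (\<gamma> t) y)"
    using velocity_is_gradient[OF V] by blast
  interpret gradient_evolution \<tau> \<gamma> m "\<lambda>t. V (\<gamma> t)" "partial \<tau> 1 1 \<gamma>" Q w e
    by unfold_locales (fact e grad)+
  have "w 0 x = 0" for x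
  proof (rule no_dissipation)
    show "energy_on e (\<gamma> 0) a b \<le> M" if "a \<le> b" for a b using M[OF that] by (simp add: start)
    show "\<exists>c d. c \<le> d \<and> energy_on e (\<gamma> 0) a b \<le> energy_on e (\<gamma> \<tau>) c d" if "a \<le> b" for a b
      unfolding start
      using isometric_recovers_energy[OF iso \<alpha> _ cont m_pos _ e M that]
        differentiable[OF I] speed_ge[OF I] by (simp add: start)
  qed
  then have const: "norm (curvature \<gamma>0 x) = norm (curvature \<gamma>0 y)" for x y
    using rigid[OF I] by (simp add: start)
  have "curvature \<gamma>0 x = 0" for x
  proof -
    have "((\<lambda>y. norm (curvature \<gamma>0 y)) \<longlongrightarrow> 0) at_infinity"
      using tendsto_norm[OF straight_ends(2)[OF I e, of M]] M by (simp add: start)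
    moreover have "(\<lambda>y. norm (curvature \<gamma>0 y)) = (\<lambda>_. norm (curvature \<gamma>0 x))"
      by (rule ext) (rule const)
    ultimately have "((\<lambda>_::real. norm (curvature \<gamma>0 x)) \<longlongrightarrow> 0) at_infinity" by (simp only:)
    then show ?thesis using tendsto_const_iff[of "at_infinity :: real filter"] by (metis norm_eq_zero trivial_limit_at_infinity)
  qed
  then show ?thesis using straight_line_of_curvature_0[OF I] by (simp add: start)
qed

theorem corollary8p1:
  fixes \<gamma>0 :: "real \<Rightarrow> real ^ 'n"
    and V :: "(real ^ 'n) velocity"
    and i1 :: 'n  \<comment> \<open>the first coordinate; an index type carries no preferred one\<close>
  assumes "CARD('n) \<ge> 2"
    and "dot_smooth \<gamma>0"
    and "0 < (INF x. norm (dx \<gamma>0 x))"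
    and "V \<in> {curve_shortening, surface_diffusion, chen}"
    and "non_scaling_profile V \<gamma>0 \<or> expanding_profile V \<gamma>0"
    and "direction_energy (axis i1 1) \<gamma>0 < \<infinity>"
  shows "straight_line \<gamma>0"
proof -
  obtain \<gamma> \<tau> \<alpha> where "\<tau> > 0" "flow_solution V \<gamma>0 \<tau> \<gamma>"
    "isometric_curves (\<gamma> \<tau>) (\<lambda>x. \<alpha> *\<^sub>R \<gamma>0 x)" "(1::real) \<le> \<alpha>"
    using assms(5)
  proof
    assume "non_scaling_profile V \<gamma>0"
    then obtain \<gamma> where "maximal_solution V \<gamma>0 \<infinity> \<gamma>" "\<forall>t\<ge>0. isometric_curves (\<gamma> t) \<gamma>0"
      unfolding non_scaling_profile_def by blast
    then show thesis using that[of 1 \<gamma> 1] by (simp add: maximal_solution_def)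
  next
    assume "expanding_profile V \<gamma>0"
    then obtain \<gamma> T \<alpha> where sol: "maximal_solution V \<gamma>0 T \<gamma>"
      and mono: "mono_on {t. 0 \<le> t \<and> ereal t < T} \<alpha>" and "\<alpha> 0 = 1"
      and iso: "\<And>t. 0 \<le> t \<Longrightarrow> ereal t < T \<Longrightarrow> isometric_curves (\<gamma> t) (\<lambda>x. \<alpha> t *\<^sub>R \<gamma>0 x)"
      unfolding expanding_profile_def by blast
    have "0 < T" using sol unfolding maximal_solution_def by blast
    then obtain \<tau> where \<tau>: "0 < \<tau>" "ereal \<tau> < T"
      using ereal_dense2[of 0 T] by auto
    have "\<alpha> 0 \<le> \<alpha> \<tau>"
      by (rule mono_onD[OF mono]) (use \<tau> \<open>0 < T\<close> in \<open>auto simp: zero_ereal_def\<close>)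
    then show thesis
      using that[of \<tau> \<gamma> "\<alpha> \<tau>"] \<tau> sol iso[of \<tau>] \<open>\<alpha> 0 = 1\<close> by (simp add: maximal_solution_def)
  qed
  moreover have "norm (axis i1 1 :: real ^ 'n) = 1" by simp
  ultimately show ?thesis
    using energy_recovering_flow_is_straight assms(2,4,6) by blast
qed

end
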